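(* Suppose the unital $\ell$-group $(G,u)$ has a basis. Then: (1) Any two basic groups $G_{\mathcal B}, G_{\mathcal F}$ of $(G,u)$ (where $\mathcal B,\mathcal F$ are bases of $(G,u)$) are jointly embeddable, by unit-preserving, order-preserving inclusions, into some basic group $G_{\mathcal B'}$ of $(G,u)$ (with $\mathcal B'$ a basis of $(G,u)$). (2) The maps $\{\phi_{\mathcal B\mathcal B'}\colon \mathbb Z_{\mathcal B}\to\mathbb Z_{\mathcal B'}\}$, indexed by all pairs $\mathcal B,\mathcal B'$ of bases of $(G,u)$ such that $\mathcal B\subseteq \mathrm{sgr}\,\mathcal B'$, form a direct system of unital simplicial groups and unital positive one-to-one homomorphisms in the category $\mathcal P$. (3) The direct limit in $\mathcal P$ of this system satisfies $\lim\{\phi_{\mathcal B\mathcal B'}\colon \mathbb Z_{\mathcal B}\to\mathbb Z_{\mathcal B'}\}\cong (G,u)_{\dim}$.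
   Context: A lattice-ordered abelian group ($\ell$-group) is a structure $(G,+,-,0,\vee,\wedge)$ such that $(G,+,-,0)$ is an abelian group, $(G,\vee,\wedge)$ is a lattice, and $x+(y\vee z)=(x+y)\vee(x+z)$ for all $x,y,z\in G$. An order-unit is an element $u\in G$ such that for every $g\in G$ there is $n\in\{1,2,\ldots\}$ with $g\le nu$. A unital $\ell$-group $(G,u)$ is an $\ell$-group $G$ with a distinguished order-unit $u$. A unital $\ell$-homomorphism $h\colon(G,u)\to(G',u')$ is a map preserving the group and lattice structure with $h(u)=u'$. An ideal of $(G,u)$ is the kernel of a unital $\ell$-homomorphism of $(G,u)$. $\mathrm{MaxSpec}(G)$ is the set of maximal (proper) ideals of $(G,u)$ with the spectral topology: a basis of closed sets is given by the sets $\{\mathfrak p\in\mathrm{MaxSpec}(G)\mid a\in\mathfrak p\}$, $a\in G$. Basis: a basis of $(G,u)$ is a set $\mathcal B=\{b_1,\ldots,b_n\}$ of nonzero elements of the positive cone $G^+=\{g\in G\mid g\ge 0\}$ such that (i) $\mathcal B$ generates $G$ (as an $\ell$-group); (ii) for each $k=1,2,\ldots$ and each $k$-element subset $C$ of $\mathcal B$ with $\bigwedge\{b\mid b\in C\}\neq 0$, the set $\{\mathfrak m\in\mathrm{MaxSpec}(G)\mid \mathfrak m\supseteq\mathcal B\setminus C\}$ is homeomorphic to a $(k-1)$-simplex; (iii) there are integers $m_1,\ldots,m_n\ge 1$ such that $\sum_{i=1}^n m_ib_i=u$. The integers $m_i$ (multiplicities) are uniquely determined. The elements of each basis are assumed to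 be listed in some prescribed order, and $m_{\mathcal B}=(m_1,\ldots,m_n)$. $\mathcal P$ is the category of partially ordered abelian groups with order-unit: objects are pairs $(H,v)$ with $H$ a partially ordered abelian group and $v$ an order-unit of $H$; morphisms are unital (unit-preserving) positive homomorphisms $\phi$ (positive means $\phi(H^+)\subseteq K^+$). A unital simplicial group is an object of $\mathcal P$ isomorphic in $\mathcal P$ to $\mathbb Z^n$, for some $n>0$, with the product ordering ($(x_1,\ldots,x_n)\ge0$ iff all $x_i\ge0$) and some order-unit. $(G,u)_{\dim}$ is the object of $\mathcal P$ given by the underlying group of $G$ with the same positive cone $G^+$ and order-unit $u$, forgetting the lattice structure. For a basis $\mathcal B=\{b_1,\ldots,b_n\}$ of $(G,u)$: $\mathrm{grp}\,\mathcal B=\mathbb Zb_1+\cdots+\mathbb Zb_n$ and $\mathrm{sgr}\,\mathcal B=\mathbb Z_{\ge0}b_1+\cdots+\mathbb Z_{\ge0}b_n$, as subsets of $G$. The basic group of $\mathcal B$ is $G_{\mathcal B}=(\mathrm{grp}\,\mathcal B,\mathrm{sgr}\,\mathcal B,u)$, i.e. the group $\mathrm{grp}\,\mathcal B$ with positive cone $\mathrm{sgr}\,\mathcal B$ and distinguished element $u=\sum m_ib_i$. $\mathbb Z_{\mathcal B}=(\mathbb Z^n,(\mathbb Z_{\ge0})^n,m_{\mathcal B})$ is $\mathbb Z^n$ with the product order and distinguished element $m_{\mathcal B}$. If $\mathcal B'=\{b_1',\ldots,b'_{n'}\}$ is a basis of $(G,u)$ with $\mathcal B\subseteq\mathrm{sgr}\,\mathcal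 B'$, then $b_i=m_{1i}b_1'+\cdots+m_{n'i}b'_{n'}$ for uniquely determined integers $m_{ki}\ge 0$; $M_{\mathcal B\mathcal B'}$ is the $n'\times n$ matrix $(m_{ki})$, and $\phi_{\mathcal B\mathcal B'}\colon\mathbb Z^n\to\mathbb Z^{n'}$ is the map $y\mapsto M_{\mathcal B\mathcal B'}\,y$ (the map corresponding to the inclusion $\mathrm{grp}\,\mathcal B\subseteq\mathrm{grp}\,\mathcal B'$ under $b_i\mapsto e_i$, $b'_k\mapsto e_k$). *)

theory Defs
  imports
    "HOL-Library.Lattice_Algebras"
    "HOL-Algebra.Coset"
    "HOL-Homology.Simplices"
begin

section \<open>Unital l-groups\<close>

text \<open>
  The ambient l-group is a type of class \<^class>\<open>lattice_ab_group_add\<close>. The groups that are quantified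
  over or constructed (codomains of homomorphisms, objects of the category of partially ordered
  groups) are records over \<^typ>\<open>'a monoid\<close>, in the multiplicative notation of HOL-Algebra: the
  group sum is \<open>\<otimes>\<close>, zero is \<open>\<one>\<close> and the multiple \<open>k x\<close> is \<open>x [^] k\<close>.
\<close>

definition additive_group :: "'a::ab_group_add monoid" where
  "additive_group = \<lparr>carrier = UNIV, mult = (+), one = 0\<rparr>"

abbreviation zmult :: "int \<Rightarrow> 'a::ab_group_add \<Rightarrow> 'a" (infixr \<open>\<odot>\<close> 75) where
  "k \<odot> x \<equiv> x [^]\<^bsub>additive_group\<^esub> k"

definition order_unit :: "'a::lattice_ab_group_add \<Rightarrow> bool" where
  "order_unit u \<longleftrightarrow> (\<forall>g. \<exists>n::nat. n \<ge> 1 \<and> g \<le> int n \<odot> u)"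

record 'a ulgroup = "'a monoid" +
  join :: "'a \<Rightarrow> 'a \<Rightarrow> 'a"
  meet :: "'a \<Rightarrow> 'a \<Rightarrow> 'a"
  lunit :: 'a

definition unital_lgroup :: "'a ulgroup \<Rightarrow> bool" where
  "unital_lgroup H \<longleftrightarrow>
     comm_group H \<and>
     (\<forall>x\<in>carrier H. \<forall>y\<in>carrier H. join H x y \<in> carrier H \<and> meet H x y \<in> carrier H) \<and>
     (\<forall>x\<in>carrier H. \<forall>y\<in>carrier H.
        join H x y = join H y x \<and> meet H x y = meet H y x \<and>
        join H x (meet H x y) = x \<and> meet H x (join H x y) = x) \<and>
     (\<forall>x\<in>carrier H. \<forall>y\<in>carrier H. \<forall>z\<in>carrier H.
        join H (join H x y) z = join H x (join H y z) \<and>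
        meet H (meet H x y) z = meet H x (meet H y z) \<and>
        x \<otimes>\<^bsub>H\<^esub> join H y z = join H (x \<otimes>\<^bsub>H\<^esub> y) (x \<otimes>\<^bsub>H\<^esub> z)) \<and>
     lunit H \<in> carrier H \<and>
     (\<forall>x\<in>carrier H. \<exists>n::nat. n \<ge> 1 \<and>
        join H x (lunit H [^]\<^bsub>H\<^esub> n) = lunit H [^]\<^bsub>H\<^esub> n)"

definition lgroup_of :: "'a::lattice_ab_group_add \<Rightarrow> 'a ulgroup" where
  "lgroup_of u = \<lparr>carrier = UNIV, mult = (+), one = 0, join = sup, meet = inf, lunit = u\<rparr>"

lemma comm_group_lgroup_of: "comm_group (lgroup_of u)"
  by (rule comm_groupI) (auto simp: lgroup_of_def ac_simps intro: exI[of _ "- _"] left_minus)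

lemma nat_pow_lgroup_of: "u [^]\<^bsub>lgroup_of v\<^esub> (n::nat) = int n \<odot> u"
  unfolding int_pow_int
  by (induction n) (simp_all add: lgroup_of_def additive_group_def nat_pow_def)

lemma unital_lgroup_of: "unital_lgroup (lgroup_of u) \<longleftrightarrow> order_unit u"
proof -
  have "unital_lgroup (lgroup_of u) \<longleftrightarrow> (\<forall>x. \<exists>n::nat. n \<ge> 1 \<and> sup x (int n \<odot> u) = int n \<odot> u)"
    unfolding unital_lgroup_def nat_pow_lgroup_of
    using comm_group_lgroup_of[of u]
    by (simp add: lgroup_of_def nat_pow_lgroup_of[unfolded lgroup_of_def] ac_simps
          add_sup_distrib_left)
  then show ?thesis by (simp add: order_unit_def le_iff_sup)
qed

definition unital_lhom :: "'a ulgroup \<Rightarrow> 'b ulgroup \<Rightarrow> ('a \<Rightarrow> 'b) set" where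
  "unital_lhom G H = {h \<in> hom G H.
     (\<forall>x\<in>carrier G. \<forall>y\<in>carrier G.
        h (join G x y) = join H (h x) (h y) \<and> h (meet G x y) = meet H (h x) (h y)) \<and>
     h (lunit G) = lunit H}"


section \<open>Ideals and the maximal spectral space\<close>

text \<open>
  An ideal is the kernel of a homomorphism into an arbitrary unital l-group. Replacing the codomain
  by the image, whose elements correspond to the fibres of the homomorphism, one may take the
  codomain to consist of subsets of the ambient group; \<open>l_ideal_kernel\<close> below shows that the
  type \<^typ>\<open>'a set\<close> is no restriction.
\<close>

definition l_ideal :: "'a::lattice_ab_group_add \<Rightarrow> 'a set \<Rightarrow> bool" where
  "l_ideal u I \<longleftrightarrow> (\<exists>(H :: 'a set ulgroup) h.
     unital_lgroup H \<and> h \<in> unital_lhom (lgroup_of u) H \<and> I = kernel (lgroup_of u) H h)"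

lemma l_ideal_kernel:
  fixes H :: "'b ulgroup" and u :: "'a::lattice_ab_group_add"
  assumes u: "order_unit u" and H: "unital_lgroup H" and h: "h \<in> unital_lhom (lgroup_of u) H"
  shows "l_ideal u (kernel (lgroup_of u) H h)"
proof -
  have hadd: "h (x + y) = h x \<otimes>\<^bsub>H\<^esub> h y" for x y
    using h by (auto simp: unital_lhom_def lgroup_of_def hom_def)
  have hsup: "h (sup x y) = join H (h x) (h y)" and hinf: "h (inf x y) = meet H (h x) (h y)" for x y
    using h by (auto simp: unital_lhom_def lgroup_of_def hom_def)
  define q where "q x = h -` {h x}" for x
  define r where "r X = (SOME x. x \<in> X)" for X :: "'a set"
  have "r (q x) \<in> q x" for x unfolding r_def by (rule someI[of _ x]) (simp add: q_def)
  then have hr: "h (r (q x)) = h x" for x by (auto simp: q_def)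
  have qeq: "q x = q y \<longleftrightarrow> h x = h y" for x y by (auto simp: q_def)
  define K :: "'a set ulgroup" where
    "K = \<lparr>carrier = range q, mult = (\<lambda>X Y. q (r X + r Y)), one = q 0,
      join = (\<lambda>X Y. q (sup (r X) (r Y))), meet = (\<lambda>X Y. q (inf (r X) (r Y))), lunit = q u\<rparr>"
  have ops: "q x \<otimes>\<^bsub>K\<^esub> q y = q (x + y)" "join K (q x) (q y) = q (sup x y)"
    "meet K (q x) (q y) = q (inf x y)" "carrier K = range q" "\<one>\<^bsub>K\<^esub> = q 0" "lunit K = q u" for x y
    by (simp_all add: K_def qeq hadd hsup hinf hr)
  have cg: "comm_group K"
  proof (rule comm_groupI)
    fix X assume "X \<in> carrier K"
    then obtain x where "X = q x" by (auto simp: ops)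
    then show "\<exists>Y\<in>carrier K. Y \<otimes>\<^bsub>K\<^esub> X = \<one>\<^bsub>K\<^esub>"
      by (intro bexI[of _ "q (- x)"]) (simp_all add: ops)
  qed (auto simp: ops ac_simps)
  have pw: "q x [^]\<^bsub>K\<^esub> (n::nat) = q (int n \<odot> x)" for x n
    unfolding int_pow_int
    by (induction n) (simp_all add: additive_group_def nat_pow_def ops)
  have "\<exists>n::nat. n \<ge> 1 \<and> join K (q x) (q u [^]\<^bsub>K\<^esub> n) = q u [^]\<^bsub>K\<^esub> n" for x
    using u unfolding order_unit_def pw ops by (metis sup_absorb2)
  then have "unital_lgroup K"
    unfolding unital_lgroup_def using cg
    by (simp add: ops ac_simps add_sup_distrib_left)
  moreover have "q \<in> unital_lhom (lgroup_of u) K"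
    by (auto simp: unital_lhom_def lgroup_of_def hom_def ops)
  moreover have "kernel (lgroup_of u) H h = kernel (lgroup_of u) K q"
  proof -
    interpret comm_group H using H by (simp add: unital_lgroup_def)
    have "h 0 \<in> carrier H" using h by (auto simp: unital_lhom_def lgroup_of_def hom_def)
    then have "h 0 = \<one>\<^bsub>H\<^esub>" using hadd[of 0 0] by simp
    then show ?thesis by (auto simp: kernel_def ops qeq)
  qed
  ultimately show ?thesis unfolding l_ideal_def by blast
qed

definition MaxSpec :: "'a::lattice_ab_group_add \<Rightarrow> 'a set set" where
  "MaxSpec u = {M. l_ideal u M \<and> M \<noteq> UNIV \<and>
     (\<forall>I. l_ideal u I \<and> I \<noteq> UNIV \<and> M \<subseteq> I \<longrightarrow> I = M)}"

definition spectral_topology :: "'a::lattice_ab_group_add \<Rightarrow> 'a set topology" where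
  "spectral_topology u =
     topology_generated_by (range (\<lambda>a. MaxSpec u - {M \<in> MaxSpec u. a \<in> M}))"


section \<open>Bases\<close>

inductive_set l_generated :: "'a::lattice_ab_group_add set \<Rightarrow> 'a set" for B where
  gen: "b \<in> B \<Longrightarrow> b \<in> l_generated B"
| zero: "0 \<in> l_generated B"
| add: "x \<in> l_generated B \<Longrightarrow> y \<in> l_generated B \<Longrightarrow> x + y \<in> l_generated B"
| neg: "x \<in> l_generated B \<Longrightarrow> - x \<in> l_generated B"
| sup: "x \<in> l_generated B \<Longrightarrow> y \<in> l_generated B \<Longrightarrow> sup x y \<in> l_generated B"
| inf: "x \<in> l_generated B \<Longrightarrow> y \<in> l_generated B \<Longrightarrow> inf x y \<in> l_generated B"

text \<open>
  The list \<open>b\<^sub>1, \<dots>, b\<^sub>n\<close> is nonempty, in accordance with \<open>n > 0\<close> for simplicial groups; this only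
  matters for the trivial group, for which the empty set would satisfy the other conditions.
\<close>

definition is_basis :: "'a::lattice_ab_group_add \<Rightarrow> 'a set \<Rightarrow> bool" where
  "is_basis u B \<longleftrightarrow>
     finite B \<and> B \<noteq> {} \<and> (\<forall>b\<in>B. 0 \<le> b \<and> b \<noteq> 0) \<and>
     l_generated B = UNIV \<and>
     (\<forall>k\<ge>1. \<forall>C\<subseteq>B. card C = k \<and> Inf_fin C \<noteq> 0 \<longrightarrow>
        subtopology (spectral_topology u) {M \<in> MaxSpec u. B - C \<subseteq> M}
          homeomorphic_space
        subtopology (powertop_real UNIV) (standard_simplex (k - 1))) \<and>
     (\<exists>m :: 'a \<Rightarrow> int. (\<forall>b\<in>B. m b \<ge> 1) \<and> (\<Sum>b\<in>B. m b \<odot> b) = u)"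

definition bases :: "'a::lattice_ab_group_add \<Rightarrow> 'a set set" where
  "bases u = {B. is_basis u B}"

definition grp :: "'a::ab_group_add set \<Rightarrow> 'a set" where
  "grp B = {\<Sum>b\<in>B. c b \<odot> b | c :: 'a \<Rightarrow> int. True}"

definition sgr :: "'a::ab_group_add set \<Rightarrow> 'a set" where
  "sgr B = {\<Sum>b\<in>B. c b \<odot> b | c :: 'a \<Rightarrow> int. \<forall>b\<in>B. 0 \<le> c b}"


section \<open>The category of partially ordered abelian groups with order-unit\<close>

record 'a pogroup = "'a monoid" +
  pcone :: "'a set"
  punit :: 'a

text \<open>The partial order is \<open>x \<le> y \<longleftrightarrow> y - x \<in> pcone H\<close>.\<close>

definition P_object :: "'a pogroup \<Rightarrow> bool" where
  "P_object H \<longleftrightarrow>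
     comm_group H \<and>
     pcone H \<subseteq> carrier H \<and> \<one>\<^bsub>H\<^esub> \<in> pcone H \<and>
     (\<forall>x\<in>pcone H. \<forall>y\<in>pcone H. x \<otimes>\<^bsub>H\<^esub> y \<in> pcone H) \<and>
     (\<forall>x\<in>pcone H. inv\<^bsub>H\<^esub> x \<in> pcone H \<longrightarrow> x = \<one>\<^bsub>H\<^esub>) \<and>
     punit H \<in> carrier H \<and>
     (\<forall>x\<in>carrier H. \<exists>n::nat. n \<ge> 1 \<and> (punit H [^]\<^bsub>H\<^esub> n) \<otimes>\<^bsub>H\<^esub> inv\<^bsub>H\<^esub> x \<in> pcone H)"

text \<open>Morphisms are only relevant on the carrier of their domain.\<close>

definition P_morphism :: "'a pogroup \<Rightarrow> 'b pogroup \<Rightarrow> ('a \<Rightarrow> 'b) \<Rightarrow> bool" where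
  "P_morphism H K f \<longleftrightarrow> P_object H \<and> P_object K \<and>
     f \<in> hom H K \<and> f ` pcone H \<subseteq> pcone K \<and> f (punit H) = punit K"

definition P_isomorphic :: "'a pogroup \<Rightarrow> 'b pogroup \<Rightarrow> bool" where
  "P_isomorphic H K \<longleftrightarrow> (\<exists>f g. P_morphism H K f \<and> P_morphism K H g \<and>
     (\<forall>x\<in>carrier H. g (f x) = x) \<and> (\<forall>y\<in>carrier K. f (g y) = y))"

definition int_power :: "nat \<Rightarrow> (nat \<Rightarrow> int) \<Rightarrow> (nat \<Rightarrow> int) pogroup" where
  "int_power n v =
     \<lparr>carrier = {..<n} \<rightarrow>\<^sub>E UNIV,
      mult = (\<lambda>x y. \<lambda>i\<in>{..<n}. x i + y i),
      one = (\<lambda>i\<in>{..<n}. 0),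
      pcone = {..<n} \<rightarrow>\<^sub>E {0..},
      punit = v\<rparr>"

definition unital_simplicial_group :: "'a pogroup \<Rightarrow> bool" where
  "unital_simplicial_group H \<longleftrightarrow>
     P_object H \<and> (\<exists>n>0. \<exists>v. P_object (int_power n v) \<and> P_isomorphic H (int_power n v))"

definition P_direct_system ::
  "'i set \<Rightarrow> ('i \<Rightarrow> 'i \<Rightarrow> bool) \<Rightarrow> ('i \<Rightarrow> 'a pogroup) \<Rightarrow> ('i \<Rightarrow> 'i \<Rightarrow> 'a \<Rightarrow> 'a) \<Rightarrow> bool"
  where
  "P_direct_system I leq H f \<longleftrightarrow>
     I \<noteq> {} \<and>
     (\<forall>i\<in>I. leq i i) \<and>
     (\<forall>i\<in>I. \<forall>j\<in>I. \<forall>k\<in>I. leq i j \<and> leq j k \<longrightarrow> leq i k) \<and>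
     (\<forall>i\<in>I. \<forall>j\<in>I. \<exists>k\<in>I. leq i k \<and> leq j k) \<and>
     (\<forall>i\<in>I. P_object (H i)) \<and>
     (\<forall>i\<in>I. \<forall>j\<in>I. leq i j \<longrightarrow> P_morphism (H i) (H j) (f i j)) \<and>
     (\<forall>i\<in>I. \<forall>x\<in>carrier (H i). f i i x = x) \<and>
     (\<forall>i\<in>I. \<forall>j\<in>I. \<forall>k\<in>I. leq i j \<and> leq j k \<longrightarrow>
        (\<forall>x\<in>carrier (H i). f j k (f i j x) = f i k x))"

definition P_cocone ::
  "'i set \<Rightarrow> ('i \<Rightarrow> 'i \<Rightarrow> bool) \<Rightarrow> ('i \<Rightarrow> 'a pogroup) \<Rightarrow> ('i \<Rightarrow> 'i \<Rightarrow> 'a \<Rightarrow> 'a) \<Rightarrow>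
   'b pogroup \<Rightarrow> ('i \<Rightarrow> 'a \<Rightarrow> 'b) \<Rightarrow> bool"
  where
  "P_cocone I leq H f L p \<longleftrightarrow>
     P_object L \<and>
     (\<forall>i\<in>I. P_morphism (H i) L (p i)) \<and>
     (\<forall>i\<in>I. \<forall>j\<in>I. leq i j \<longrightarrow> (\<forall>x\<in>carrier (H i). p j (f i j x) = p i x))"

text \<open>
  The universal property, tested on objects with elements of type \<^typ>\<open>'c\<close>. The definition cannot
  quantify over types, hence the type argument; a theorem with \<^typ>\<open>'c\<close> a type variable asserts the
  universal property for all objects.
\<close>

definition P_direct_limit ::
  "'c itself \<Rightarrow> 'i set \<Rightarrow> ('i \<Rightarrow> 'i \<Rightarrow> bool) \<Rightarrow> ('i \<Rightarrow> 'a pogroup) \<Rightarrow> ('i \<Rightarrow> 'i \<Rightarrow> 'a \<Rightarrow> 'a) \<Rightarrow>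
   'b pogroup \<Rightarrow> ('i \<Rightarrow> 'a \<Rightarrow> 'b) \<Rightarrow> bool"
  where
  "P_direct_limit _ I leq H f L p \<longleftrightarrow>
     P_cocone I leq H f L p \<and>
     (\<forall>(K :: 'c pogroup) q. P_cocone I leq H f K q \<longrightarrow>
        (\<exists>g. P_morphism L K g \<and> (\<forall>i\<in>I. \<forall>x\<in>carrier (H i). g (p i x) = q i x) \<and>
           (\<forall>g'. P_morphism L K g' \<and> (\<forall>i\<in>I. \<forall>x\<in>carrier (H i). g' (p i x) = q i x) \<longrightarrow>
              (\<forall>y\<in>carrier L. g' y = g y))))"


section \<open>The groups and maps attached to bases\<close>

definition dim_group :: "'a::lattice_ab_group_add \<Rightarrow> 'a pogroup" where
  "dim_group u =
     \<lparr>carrier = UNIV, mult = (+), one = 0, pcone = {g. 0 \<le> g}, punit = u\<rparr>"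

definition basic_group :: "'a::lattice_ab_group_add \<Rightarrow> 'a set \<Rightarrow> 'a pogroup" where
  "basic_group u B =
     \<lparr>carrier = grp B, mult = (+), one = 0, pcone = sgr B, punit = u\<rparr>"

text \<open>
  From here on \<open>bs\<close> lists a basis in its prescribed order (indices start at 0). Multiplicities and
  coordinates are uniquely determined on the index range, and \<^term>\<open>undefined\<close> beyond it.
\<close>

definition lin_comb :: "'a::ab_group_add list \<Rightarrow> (nat \<Rightarrow> int) \<Rightarrow> 'a" where
  "lin_comb bs c = (\<Sum>i<length bs. c i \<odot> bs ! i)"

definition multiplicities :: "'a::ab_group_add \<Rightarrow> 'a list \<Rightarrow> nat \<Rightarrow> int" where
  "multiplicities u bs = (THE m. m \<in> {..<length bs} \<rightarrow>\<^sub>E {1..} \<and> lin_comb bs m = u)"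

definition coords :: "'a::ab_group_add list \<Rightarrow> 'a \<Rightarrow> nat \<Rightarrow> int" where
  "coords bs x = (THE c. c \<in> {..<length bs} \<rightarrow>\<^sub>E {0..} \<and> lin_comb bs c = x)"

definition Z_basis :: "'a::ab_group_add \<Rightarrow> 'a list \<Rightarrow> (nat \<Rightarrow> int) pogroup" where
  "Z_basis u bs = int_power (length bs) (multiplicities u bs)"

definition M_matrix :: "'a::ab_group_add list \<Rightarrow> 'a list \<Rightarrow> nat \<Rightarrow> nat \<Rightarrow> int" where
  "M_matrix bs bs' k i = coords bs' (bs ! i) k"

definition phi :: "'a::ab_group_add list \<Rightarrow> 'a list \<Rightarrow> (nat \<Rightarrow> int) \<Rightarrow> (nat \<Rightarrow> int)" where
  "phi bs bs' y = (\<lambda>k\<in>{..<length bs'}. \<Sum>i<length bs. M_matrix bs bs' k i * y i)"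

end

theory Submission
  imports Defs "HOL-Homology.Brouwer_Degree"
begin

text \<open>
  A basis triangulates the maximal spectrum, and refinements of triangulations do the rest.

  A state is a real-valued homomorphism of l-groups that maps \<open>u\<close> to \<open>1\<close>. By Hoelder's argument the
  maximal ideals are the kernels of the states, and the spectral topology is the topology of
  pointwise convergence of states (\<open>states_homeomorphic_MaxSpec\<close>). If \<open>b\<^sub>1, \<dots>, b\<^sub>n\<close> is a basis with
  multiplicities \<open>m\<^sub>i\<close>, a state \<open>h\<close> is determined by the numbers \<open>m\<^sub>i h(b\<^sub>i)\<close>, which are nonnegative
  with sum \<open>1\<close>: they are barycentric coordinates. For a set \<open>C\<close> of basis elements with nonzero meet,
  the definition of a basis only says that the states vanishing on the remaining basis elements form
  some space homeomorphic to a simplex of the right dimension. But then every point of the geometric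
  simplex on \<open>C\<close> is attained by a state. Indeed, by induction on the dimension the boundary is
  attained, and a contractible set that contains the boundary of a simplex and lies in it must be
  the whole simplex: radial projection from a missing point would make a sphere a retract of a
  contractible space. Hence the topological condition amounts to the existence of states with
  prescribed values on the basis; this is the locale \<open>schauder\<close>, with the two translations
  \<open>is_basis_imp_schauder\<close> and \<open>schauder_imp_is_basis\<close>.

  In this form the condition is easily transported along stellar subdivisions of an edge: if
  \<open>a, b\<close> are basis elements and \<open>c = inf a b\<close> is nonzero, replacing \<open>a, b\<close> by \<open>a - c, b - c, c\<close>
  gives a basis again (\<open>schauder_B'\<close>). Now let \<open>g\<close> be an integer combination of a basis. As long as
  some edge joins elements whose coefficients have opposite signs, subdivide such an edge with the
  largest difference of coefficients. This process stops, and then the terms with positive and with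
  negative coefficients are disjoint, so the positive part of \<open>g\<close> is the sum of the former. Since
  every element of the group is built from basis elements by group operations and positive parts,
  any finite set of nonnegative elements lies in the semigroup spanned by some refinement of a given
  basis (\<open>schauder_refine_nonneg\<close>).

  The theorem follows formally. Applied to the elements of a second basis, the last statement
  yields a common refinement. Bases are linearly independent, because the vertex belonging to a
  basis element is a state that is nonzero on this element only; so each \<open>\<int>\<^sup>n\<close> is a copy of the
  group spanned by a basis, and the maps of the system are the inclusions between these groups.
  Finally, every element is in the group spanned by some basis, and in the semigroup spanned by it if
  the element is nonnegative. So \<open>G\<close> with its positive cone is the directed union of the basic groups.
\<close>

text \<open>The symbol \<open>\<odot>\<close> denotes integer multiples only, not the action of a module.\<close>
no_notation module.smult (infixl \<open>\<odot>\<index>\<close> 70)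

section \<open>Simplices\<close>

lemma standard_simplexI:
  assumes "\<And>i. i \<le> p \<Longrightarrow> 0 \<le> x i" "\<And>i. p < i \<Longrightarrow> x i = 0" "(\<Sum>i\<le>p. x i) = 1"
  shows "x \<in> standard_simplex p"
proof -
  have "x i \<le> 1" if "i \<le> p" for i
  proof -
    have "x i \<le> (\<Sum>i\<le>p. x i)" by (rule member_le_sum) (use assms that in auto)
    then show ?thesis using assms(3) by simp
  qed
  then have "0 \<le> x i \<and> x i \<le> 1" for i using assms(1,2)[of i] by (cases "i \<le> p") auto
  then show ?thesis using assms by (simp add: standard_simplex_def)
qed

lemma contractible_space_standard_simplex:
  "contractible_space (subtopology (powertop_real UNIV) (standard_simplex p))"
  (is "contractible_space ?X")
proof -
  define a :: "nat \<Rightarrow> real" where "a = (\<lambda>j. if j = 0 then 1 else 0)"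
  have a: "a \<in> standard_simplex p" by (simp add: a_def)
  define k where "k = (\<lambda>(t::real, x). \<lambda>i. (1 - t) * x i + t * a i)"
  have pr: "continuous_map (prod_topology (top_of_set {0..1}) ?X) euclideanreal (\<lambda>z. snd z i)" for i
    by (rule continuous_map_compose[OF continuous_map_snd, unfolded o_def])
       (blast intro: continuous_map_from_subtopology [OF continuous_map_product_projection])
  have fs: "continuous_map (prod_topology (top_of_set {0..1}) ?X) euclideanreal (\<lambda>z. fst z)"
    by (metis continuous_map_fst continuous_map_into_fulltopology)
  have "continuous_map (prod_topology (top_of_set {0..1}) ?X) ?X k"
    unfolding continuous_map_in_subtopology continuous_map_componentwise_UNIV
    using a
    by (auto simp: k_def case_prod_unfold convex_standard_simplex
        intro!: continuous_intros pr fs)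
  then have "homotopic_with (\<lambda>_. True) ?X ?X id (\<lambda>_. a)"
    unfolding homotopic_with_def by (intro exI[of _ k]) (auto simp: k_def)
  then show ?thesis unfolding contractible_space_def by blast
qed

lemma continuous_map_Max:
  fixes f :: "'i \<Rightarrow> 'b \<Rightarrow> real"
  assumes "finite I" "I \<noteq> {}" "\<And>i. i \<in> I \<Longrightarrow> continuous_map X euclideanreal (f i)"
  shows "continuous_map X euclideanreal (\<lambda>x. Max ((\<lambda>i. f i x) ` I))"
  using assms
proof (induction I rule: finite_ne_induct)
  case (insert i I)
  then have "Max ((\<lambda>j. f j x) ` insert i I) = max (f i x) (Max ((\<lambda>j. f j x) ` I))" for x
    by simp
  with insert show ?case by (simp add: continuous_map_real_max)
qed simp

text \<open>
  Let \<open>z\<close> be a missing point; it is interior. The rays from \<open>z\<close> identify the boundary with the unit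
  sphere of the hyperplane of vectors with coordinate sum \<open>0\<close>, where the last coordinate is redundant.
  Projecting onto this sphere is defined on all of \<open>T\<close>, and following a ray to its exit point is a
  section of the projection. A retract of a contractible space is contractible, but a sphere is not.
\<close>
lemma contractible_supset_of_simplex_boundary:
  assumes T: "T \<subseteq> standard_simplex (Suc n)"
    and bd: "\<And>x i. x \<in> standard_simplex (Suc n) \<Longrightarrow> i \<le> Suc n \<Longrightarrow> x i = 0 \<Longrightarrow> x \<in> T"
    and contr: "contractible_space (subtopology (powertop_real UNIV) T)"
  shows "T = standard_simplex (Suc n)"
proof (rule ccontr)
  assume "T \<noteq> standard_simplex (Suc n)"
  then obtain z where z: "z \<in> standard_simplex (Suc n)" "z \<notin> T" using T by blast
  have zpos: "z i > 0" if "i \<le> Suc n" for i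
    using z bd[of z i] that by (force simp: standard_simplex_def less_le)
  define X where "X = subtopology (powertop_real UNIV) T"
  have topX: "topspace X = T" by (simp add: X_def)
  define e :: "(nat \<Rightarrow> real) \<Rightarrow> nat \<Rightarrow> real" where
    "e v = (\<lambda>i. if i \<le> n then v i else if i = Suc n then - (\<Sum>j\<le>n. v j) else 0)" for v
  (* the ray from z in the direction e v leaves the simplex at time 1 / \<gamma> v *)
  define \<gamma> where "\<gamma> v = Max ((\<lambda>i. - (e v i / z i)) ` {..Suc n})" for v
  define s where "s v = (\<lambda>i. z i + e v i / \<gamma> v)" for v
  define r :: "(nat \<Rightarrow> real) \<Rightarrow> nat \<Rightarrow> real" where
    "r x = (\<lambda>i. if i \<le> n then (x i - z i) / sqrt (\<Sum>j\<le>n. (x j - z j)\<^sup>2) else 0)" for x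
  have esum: "(\<Sum>i\<le>Suc n. e v i) = 0" for v by (simp add: e_def)
  have \<gamma>_ge: "- (e v i / z i) \<le> \<gamma> v" if "i \<le> Suc n" for v i
    unfolding \<gamma>_def using that by (intro Max_ge) auto
  have \<gamma>_at: "\<exists>i\<le>Suc n. \<gamma> v = - (e v i / z i)" for v
  proof -
    have "\<gamma> v \<in> (\<lambda>i. - (e v i / z i)) ` {..Suc n}" unfolding \<gamma>_def by (rule Max_in) auto
    then show ?thesis by auto
  qed
  have \<gamma>_pos: "\<gamma> v > 0" if v: "v \<in> topspace (nsphere n)" for v
  proof (rule ccontr)
    assume "\<not> 0 < \<gamma> v"
    then have "0 \<le> e v i / z i" if "i \<le> Suc n" for i using \<gamma>_ge[OF that, of v] by linarith
    then have "0 \<le> e v i" if "i \<le> Suc n" for i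
      using zpos[OF that] that by (metis zero_le_divide_iff not_less)
    then have "e v i = 0" if "i \<le> Suc n" for i
      using esum[of v] that by (subst (asm) sum_nonneg_eq_0_iff) auto
    then have "v i = 0" if "i \<le> n" for i using that by (metis e_def le_SucI)
    then show False using v by (simp add: nsphere)
  qed
  have s_in: "s v \<in> T" if v: "v \<in> topspace (nsphere n)" for v
  proof -
    have nn: "0 \<le> s v i" if "i \<le> Suc n" for i
      using \<gamma>_ge[OF that, of v] \<gamma>_pos[OF v] zpos[OF that] by (simp add: s_def field_simps)
    have sm: "(\<Sum>i\<le>Suc n. s v i) = 1"
      unfolding s_def sum.distrib sum_divide_distrib[symmetric] esum
      using z by (simp add: standard_simplex_def)
    have out: "s v i = 0" if "i > Suc n" for i
      using that z by (simp add: s_def e_def standard_simplex_def)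
    have "s v \<in> standard_simplex (Suc n)" using nn out sm by (rule standard_simplexI)
    moreover obtain i where i: "i \<le> Suc n" "\<gamma> v = - (e v i / z i)" using \<gamma>_at by blast
    then have "s v i = 0" using \<gamma>_pos[OF v] zpos[OF i(1)] by (simp add: s_def field_simps)
    ultimately show ?thesis using bd i(1) by blast
  qed
  have proj_nsphere: "continuous_map (nsphere n) euclideanreal (\<lambda>v. v i)" for i
    by (rule continuous_map_nsphere_projection)
  have cont_e: "continuous_map (nsphere n) euclideanreal (\<lambda>v. e v i)" for i
    unfolding e_def
    by (cases "i \<le> n"; cases "i = Suc n") (auto intro!: continuous_intros proj_nsphere)
  have cont_\<gamma>: "continuous_map (nsphere n) euclideanreal \<gamma>"
    unfolding \<gamma>_def
    by (rule continuous_map_Max) (use zpos in \<open>force intro!: continuous_intros cont_e\<close>)+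
  have cont_s: "continuous_map (nsphere n) X s"
    unfolding X_def continuous_map_in_subtopology continuous_map_componentwise_UNIV s_def
    using s_in \<gamma>_pos
    by (force simp: s_def intro!: continuous_intros cont_e cont_\<gamma>)
  have nz: "(\<Sum>j\<le>n. (x j - z j)\<^sup>2) > 0" if "x \<in> T" for x
  proof (rule ccontr)
    assume "\<not> ?thesis"
    then have "(\<Sum>j\<le>n. (x j - z j)\<^sup>2) = 0" by (meson less_eq_real_def linorder_not_less sum_nonneg zero_le_power2)
    then have eq: "x j = z j" if "j \<le> n" for j
      using that by (subst (asm) sum_nonneg_eq_0_iff) auto
    have x: "x \<in> standard_simplex (Suc n)" using that T by blast
    have "(\<Sum>j\<le>Suc n. x j) = (\<Sum>j\<le>Suc n. z j)" using x z by (simp add: standard_simplex_def)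
    then have "x (Suc n) = z (Suc n)" using eq by simp
    then have "x j = z j" for j
      using eq x z by (cases "j \<le> n"; cases "j = Suc n") (auto simp: standard_simplex_def)
    then show False using that z by (metis ext)
  qed
  have proj_X: "continuous_map X euclideanreal (\<lambda>x. x i)" for i
    unfolding X_def by (intro continuous_map_from_subtopology continuous_map_product_projection) auto
  have cont_r: "continuous_map X (nsphere n) r"
    unfolding nsphere continuous_map_in_subtopology continuous_map_componentwise_UNIV
  proof (intro conjI allI)
    fix i
    show "continuous_map X euclideanreal (\<lambda>x. r x i)"
      unfolding r_def
      by (cases "i \<le> n") (use nz topX in \<open>force intro!: continuous_intros proj_X\<close>)+
  next
    have "(\<Sum>i\<le>n. (r x i)\<^sup>2) = 1" if "x \<in> T" for x
      using nz[OF that] by (simp add: r_def power_divide flip: sum_divide_distrib)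
    then show "r \<in> topspace X \<rightarrow> {x. (\<Sum>i\<le>n. (x i)\<^sup>2) = 1 \<and> (\<forall>i>n. x i = 0)}"
      by (auto simp: topX r_def)
  qed
  have rs: "r (s v) = v" if v: "v \<in> topspace (nsphere n)" for v
  proof -
    have "sqrt (\<Sum>j\<le>n. (s v j - z j)\<^sup>2) = 1 / \<gamma> v"
    proof -
      have "(\<Sum>j\<le>n. (s v j - z j)\<^sup>2) = (\<Sum>j\<le>n. (v j)\<^sup>2) / (\<gamma> v)\<^sup>2"
        by (simp add: s_def e_def power_divide sum_divide_distrib)
      also have "\<dots> = (1 / \<gamma> v)\<^sup>2" using v by (simp add: nsphere power_divide)
      finally show ?thesis using \<gamma>_pos[OF v] by simp
    qed
    then show ?thesis
      using \<gamma>_pos[OF v] v by (auto simp: r_def s_def e_def nsphere fun_eq_iff)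
  qed
  have "retraction_maps X (nsphere n) r s"
    using cont_r cont_s rs by (simp add: retraction_maps_def)
  then have "contractible_space (nsphere n)"
    using contractible_space_retraction_map_image contr
    unfolding X_def retraction_map_def by blast
  then show False using non_contractible_space_nsphere by blast
qed

section \<open>Integer multiples\<close>

lemma comm_group_additive_group: "comm_group (additive_group :: 'a::ab_group_add monoid)"
  by (rule comm_groupI)
     (auto simp: additive_group_def ac_simps intro: exI[of _ "- _"] left_minus)

interpretation additive: comm_group "additive_group :: 'a::ab_group_add monoid"
  rewrites "carrier (additive_group :: 'a monoid) = UNIV"
    and "x \<otimes>\<^bsub>additive_group :: 'a monoid\<^esub> y = x + y"
    and "\<one>\<^bsub>additive_group :: 'a monoid\<^esub> = 0"
  using comm_group_additive_group by (auto simp: additive_group_def)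

lemma one_additive_group [simp]: "\<one>\<^bsub>additive_group\<^esub> = 0"
  by (simp add: additive_group_def)

lemma zmult_add_left: "(k + l) \<odot> x = k \<odot> x + l \<odot> x"
  by (simp add: additive.int_pow_mult)

lemma zmult_add_right: "k \<odot> (x + y) = k \<odot> x + k \<odot> y"
  by (simp add: additive.int_pow_distrib)

lemma zmult_zero_left [simp]: "0 \<odot> x = 0"
  by simp

lemma zmult_one [simp]: "1 \<odot> x = x"
  by (simp add: additive.int_pow_1)

lemma zmult_zero_right [simp]: "k \<odot> 0 = 0"
  using zmult_add_right[of 0 0 k] by simp

lemma zmult_minus_right: "k \<odot> (- x) = - (k \<odot> x)"
  using zmult_add_right[of x "- x" k] by (simp add: eq_neg_iff_add_eq_0 add.commute)

lemma zmult_minus_left: "(- k) \<odot> x = - (k \<odot> x)"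
  using zmult_add_left[of x k "- k"] by (simp add: eq_neg_iff_add_eq_0 add.commute)

lemma zmult_diff_left: "(k - l) \<odot> x = k \<odot> x - l \<odot> x"
  using zmult_add_left[of x k "- l"] by (simp add: zmult_minus_left)

lemma zmult_diff_right: "k \<odot> (x - y) = k \<odot> x - k \<odot> y"
  using zmult_add_right[of x "- y" k] by (simp add: zmult_minus_right)

lemma zmult_zmult: "k \<odot> l \<odot> x = (k * l) \<odot> x"
  by (simp add: additive.int_pow_pow mult.commute)

lemma zmult_sum_left: "(\<Sum>i\<in>I. c i) \<odot> x = (\<Sum>i\<in>I. c i \<odot> x)"
  by (induction I rule: infinite_finite_induct) (simp_all add: zmult_add_left)

lemma zmult_sum_right: "k \<odot> (\<Sum>i\<in>I. x i) = (\<Sum>i\<in>I. k \<odot> x i)"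
  by (induction I rule: infinite_finite_induct) (simp_all add: zmult_add_right)

lemma zmult_nonneg:
  fixes x :: "'a::ordered_ab_group_add"
  assumes "0 \<le> k" "0 \<le> x"
  shows "0 \<le> k \<odot> x"
  using assms(1)
  by (induction k rule: int_ge_induct) (use assms(2) in \<open>auto simp: zmult_add_left\<close>)

lemma zmult_mono_right:
  fixes x :: "'a::ordered_ab_group_add"
  assumes "0 \<le> k" "x \<le> y"
  shows "k \<odot> x \<le> k \<odot> y"
  using zmult_nonneg[of k "y - x"] assms by (simp add: zmult_diff_right)

lemma zmult_mono_left:
  fixes x :: "'a::ordered_ab_group_add"
  assumes "k \<le> l" "0 \<le> x"
  shows "k \<odot> x \<le> l \<odot> x"
  using zmult_nonneg[of "l - k" x] assms by (simp add: zmult_diff_left)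

section \<open>Disjoint elements\<close>

text \<open>
  Elements disjoint from a given one are closed under sums, which is why positive and negative parts
  of a linear combination can be read off from pairwise disjointness of its terms.
\<close>
lemma inf_add_eq_zero:
  fixes x y z :: "'a::lattice_ab_group_add"
  assumes "0 \<le> x" "0 \<le> y" "0 \<le> z" "inf x y = 0" "inf x z = 0"
  shows "inf x (y + z) = 0"
proof -
  have "inf x (y + z) \<le> inf (x + z) (y + z)" using \<open>0 \<le> z\<close> by (meson add_increasing2 inf_mono order_refl)
  also have "\<dots> = z" using \<open>inf x y = 0\<close> by (simp flip: add_inf_distrib_right)
  finally have "inf x (y + z) \<le> inf x z" by simp
  then show ?thesis using assms by (simp add: antisym)
qed

lemma inf_zmult_eq_zero:
  fixes x y :: "'a::lattice_ab_group_add"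
  assumes "0 \<le> k" and "0 \<le> x" "0 \<le> y" "inf x y = 0"
  shows "inf x (k \<odot> y) = 0"
  using assms(1)
proof (induction k rule: int_ge_induct)
  case base then show ?case using assms by (simp add: inf_absorb2)
next
  case (step i) then show ?case
    using assms by (simp add: zmult_add_left inf_add_eq_zero zmult_nonneg)
qed

lemma inf_sum_eq_zero:
  fixes x :: "'a::lattice_ab_group_add"
  assumes "0 \<le> x" "\<And>i. i \<in> I \<Longrightarrow> 0 \<le> f i" "\<And>i. i \<in> I \<Longrightarrow> inf x (f i) = 0"
  shows "inf x (\<Sum>i\<in>I. f i) = 0"
  using assms(2,3)
  by (induction I rule: infinite_finite_induct)
     (simp_all add: inf_absorb2 assms(1) inf_add_eq_zero sum_nonneg)

lemma diff_pprt_eq: "pprt x - pprt (- x) = (x :: 'a::lattice_ab_group_add)"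
  using prts[of x] by (simp add: pprt_neg)

lemma pprt_diff_of_disjoint:
  fixes x y :: "'a::lattice_ab_group_add"
  assumes "inf x y = 0"
  shows "pprt (x - y) = x"
proof -
  have "pprt (x - y) + y = sup x y" by (simp add: pprt_def add_sup_distrib_right)
  then show ?thesis using add_eq_inf_sup[of x y] assms by (metis add.right_neutral add_right_cancel)
qed

lemma inf_pprt_pprt_minus: "inf (pprt x) (pprt (- x)) = (0 :: 'a::lattice_ab_group_add)"
proof -
  have "inf (pprt x) (pprt (- x)) = inf (x + pprt (- x)) (0 + pprt (- x))"
    using diff_pprt_eq[of x] by (metis add_0 diff_eq_eq)
  also have "\<dots> = nprt x + pprt (- x)" by (simp only: nprt_def add_inf_distrib_right)
  finally show ?thesis by (simp add: pprt_neg)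
qed

text \<open>
  The negative part of \<open>x\<close> lies below a multiple of the positive part, from which it is disjoint.
\<close>
lemma zmult_nonneg_cancel:
  fixes x :: "'a::lattice_ab_group_add"
  assumes "1 \<le> k" "0 \<le> k \<odot> x"
  shows "0 \<le> x"
proof -
  have "pprt (- x) \<le> k \<odot> pprt (- x)" using zmult_mono_left[OF assms(1) zero_le_pprt] by simp
  also have "\<dots> \<le> k \<odot> pprt x"
    using assms(2) diff_pprt_eq[of x] zmult_diff_right[of "pprt x" "pprt (- x)" k] by simp
  finally have "pprt (- x) = inf (pprt (- x)) (k \<odot> pprt x)" by (simp add: inf_absorb1)
  also have "\<dots> = 0"
    by (rule inf_zmult_eq_zero) (use assms(1) in \<open>simp_all add: inf_commute inf_pprt_pprt_minus\<close>)
  finally show ?thesis by (metis le_zero_iff_zero_pprt neg_le_0_iff_le)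
qed

lemma order_unit_nonneg:
  assumes "order_unit u"
  shows "0 \<le> u"
proof -
  obtain n :: nat where "n \<ge> 1" "0 \<le> int n \<odot> u" using assms unfolding order_unit_def by blast
  then show ?thesis by (intro zmult_nonneg_cancel[of "int n" u]) simp_all
qed

section \<open>Ideals\<close>



text \<open>
  The intrinsic description of ideals. Closure under binary suprema and infima reduces to closure
  under positive parts.
\<close>
definition convex_lsubgroup :: "'a::lattice_ab_group_add set \<Rightarrow> bool" where
  "convex_lsubgroup I \<longleftrightarrow> 0 \<in> I \<and> (\<forall>x\<in>I. \<forall>y\<in>I. x + y \<in> I) \<and> (\<forall>x\<in>I. - x \<in> I) \<and>
     (\<forall>x\<in>I. pprt x \<in> I) \<and> (\<forall>x. \<forall>y\<in>I. 0 \<le> x \<and> x \<le> y \<longrightarrow> x \<in> I)"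

lemma convex_lsubgroupD:
  assumes "convex_lsubgroup I"
  shows "0 \<in> I" "x \<in> I \<Longrightarrow> y \<in> I \<Longrightarrow> x + y \<in> I" "x \<in> I \<Longrightarrow> - x \<in> I" "x \<in> I \<Longrightarrow> pprt x \<in> I"
    "x \<in> I \<Longrightarrow> y \<in> I \<Longrightarrow> x - y \<in> I" "0 \<le> x \<Longrightarrow> x \<le> y \<Longrightarrow> y \<in> I \<Longrightarrow> x \<in> I"
  using assms unfolding convex_lsubgroup_def by (metis diff_conv_add_uminus)+

lemma convex_lsubgroup_sandwich:
  assumes I: "convex_lsubgroup I" and "x \<le> a" "- x \<le> b" "a \<in> I" "b \<in> I"
  shows "x \<in> I"
proof -
  have "pprt x \<le> pprt a" "pprt (- x) \<le> pprt b" using assms by simp_all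
  then have "pprt x \<in> I" "pprt (- x) \<in> I"
    using convex_lsubgroupD(4,6)[OF I] assms(4,5) zero_le_pprt by blast+
  then show ?thesis using convex_lsubgroupD(5)[OF I] diff_pprt_eq[of x] by metis
qed

lemma convex_lsubgroup_zmult:
  assumes I: "convex_lsubgroup I" and x: "x \<in> I"
  shows "k \<odot> x \<in> I"
proof (induction k rule: int_induct[of _ 0])
  case base then show ?case using convex_lsubgroupD(1)[OF I] by simp
next
  case (step1 i) then show ?case
    using convex_lsubgroupD(2)[OF I _ x] by (simp add: zmult_add_left)
next
  case (step2 i) then show ?case
    using convex_lsubgroupD(5)[OF I _ x] by (simp add: zmult_diff_left)
qed

lemma convex_lsubgroup_sup_diff:
  assumes I: "convex_lsubgroup I" and x: "x - x' \<in> I" and y: "y - y' \<in> I"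
  shows "sup x y - sup x' y' \<in> I"
proof (rule convex_lsubgroup_sandwich[OF I])
  have *: "sup a b - sup a' b' \<le> pprt (a - a') + pprt (b - b')" for a a' b b' :: 'a
  proof -
    have "a \<le> sup a' b' + (pprt (a - a') + pprt (b - b'))"
      using add_mono[OF sup_ge1[of a' b'] add_increasing2[OF zero_le_pprt[of "b - b'"], of "a - a'" "pprt (a - a')"]]
      by (simp add: pprt_def)
    moreover have "b \<le> sup a' b' + (pprt (a - a') + pprt (b - b'))"
      using add_mono[OF sup_ge2[of b' a'] add_increasing[OF zero_le_pprt[of "a - a'"], of "b - b'" "pprt (b - b')"]]
      by (simp add: pprt_def)
    ultimately have "sup a b \<le> sup a' b' + (pprt (a - a') + pprt (b - b'))" by simp
    then show ?thesis by (subst diff_le_eq) (simp only: add.commute)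
  qed
  show "sup x y - sup x' y' \<le> pprt (x - x') + pprt (y - y')" by (rule *)
  show "- (sup x y - sup x' y') \<le> pprt (- (x - x')) + pprt (- (y - y'))"
    using *[of x' y' x y] by (simp only: minus_diff_eq)
  show "pprt (x - x') + pprt (y - y') \<in> I"
    "pprt (- (x - x')) + pprt (- (y - y')) \<in> I"
    using convex_lsubgroupD[OF I] x y by blast+
qed

text \<open>
  From left to right, absorption in the codomain gives convexity. From right to left, the ideal is
  the kernel of the projection to its cosets; joins and meets of cosets are well defined because
  \<open>sup\<close> moves by at most the sum of the moves of its arguments.
\<close>
lemma l_ideal_iff_convex_lsubgroup:
  fixes u :: "'a::lattice_ab_group_add"
  assumes u: "order_unit u"
  shows "l_ideal u I \<longleftrightarrow> convex_lsubgroup I"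
proof
  assume "l_ideal u I"
  then obtain H :: "'a set ulgroup" and h where H: "unital_lgroup H"
    and h: "h \<in> unital_lhom (lgroup_of u) H" and I: "I = kernel (lgroup_of u) H h"
    unfolding l_ideal_def by blast
  interpret comm_group H using H by (simp add: unital_lgroup_def)
  have hc: "h x \<in> carrier H" and hadd: "h (x + y) = h x \<otimes>\<^bsub>H\<^esub> h y"
    and hsup: "h (sup x y) = join H (h x) (h y)" and hinf: "h (inf x y) = meet H (h x) (h y)" for x y
    using h by (auto simp: unital_lhom_def lgroup_of_def hom_def)
  have absorb: "join H a (meet H a b) = a" "join H a b = join H b a" "meet H a b = meet H b a"
    if "a \<in> carrier H" "b \<in> carrier H" for a b
    using H that unfolding unital_lgroup_def by simp_all
  have h0: "h 0 = \<one>\<^bsub>H\<^esub>" using hadd[of 0 0] hc[of 0] by simp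
  have mem: "x \<in> I \<longleftrightarrow> h x = \<one>\<^bsub>H\<^esub>" for x by (simp add: I kernel_def lgroup_of_def)
  show "convex_lsubgroup I"
    unfolding convex_lsubgroup_def mem
  proof (intro conjI ballI allI impI, unfold mem)
    show "h 0 = \<one>\<^bsub>H\<^esub>" by (rule h0)
  next
    fix x y assume "h x = \<one>\<^bsub>H\<^esub>" "h y = \<one>\<^bsub>H\<^esub>"
    then show "h (x + y) = \<one>\<^bsub>H\<^esub>" by (simp add: hadd)
  next
    fix x assume "h x = \<one>\<^bsub>H\<^esub>"
    then show "h (- x) = \<one>\<^bsub>H\<^esub>" using hadd[of "- x" x] h0 hc[of "- x"] by simp
  next
    fix x assume x: "h x = \<one>\<^bsub>H\<^esub>"
    then show "h (pprt x) = \<one>\<^bsub>H\<^esub>"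
      using hsup[of x x] hsup[of x 0] h0 by (simp add: pprt_def)
  next
    fix x y assume y: "h y = \<one>\<^bsub>H\<^esub>" and xy: "0 \<le> x \<and> x \<le> y"
    have "\<one>\<^bsub>H\<^esub> = meet H (h x) \<one>\<^bsub>H\<^esub>" using hinf[of x 0] xy h0 by (simp add: inf_absorb2)
    moreover have "\<one>\<^bsub>H\<^esub> = join H (h x) \<one>\<^bsub>H\<^esub>" using hsup[of x y] xy y by (simp add: sup_absorb2)
    ultimately show "h x = \<one>\<^bsub>H\<^esub>" using absorb(1)[OF hc[of x] one_closed] by metis
  qed
next
  assume I: "convex_lsubgroup I"
  note ID = convex_lsubgroupD[OF I]
  define q where "q x = {y. y - x \<in> I}" for x
  define r where "r X = (SOME x. x \<in> X)" for X :: "'a set"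
  have "r (q x) \<in> q x" for x unfolding r_def by (rule someI[of _ x]) (simp add: q_def ID)
  then have rq: "r (q x) - x \<in> I" for x by (simp add: q_def)
  have qeq: "q x = q y \<longleftrightarrow> x - y \<in> I" for x y
  proof
    assume "q x = q y"
    moreover have "x \<in> q x" by (simp add: q_def ID)
    ultimately show "x - y \<in> I" by (simp add: q_def)
  next
    assume *: "x - y \<in> I"
    have "z - x \<in> I \<longleftrightarrow> z - y \<in> I" for z
      using ID(2)[OF _ *, of "z - x"] ID(5)[OF _ *, of "z - y"] by (auto simp: algebra_simps)
    then show "q x = q y" by (simp add: q_def)
  qed
  have qadd: "q (r (q x) + r (q y)) = q (x + y)" for x y
    unfolding qeq using ID(2)[OF rq[of x] rq[of y]] by (simp add: algebra_simps)
  have qsup: "q (sup (r (q x)) (r (q y))) = q (sup x y)" for x y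
    unfolding qeq by (rule convex_lsubgroup_sup_diff[OF I rq rq])
  have qinf: "q (inf (r (q x)) (r (q y))) = q (inf x y)" for x y
  proof -
    have "- r (q a) - - a \<in> I" for a using ID(3)[OF rq[of a]] by simp
    from ID(3)[OF convex_lsubgroup_sup_diff[OF I this[of x] this[of y]]]
    show ?thesis
      unfolding qeq inf_eq_neg_sup by (simp only: diff_conv_add_uminus minus_add_distrib minus_minus)
  qed
  define K :: "'a set ulgroup" where
    "K = \<lparr>carrier = range q, mult = (\<lambda>X Y. q (r X + r Y)), one = q 0,
      join = (\<lambda>X Y. q (sup (r X) (r Y))), meet = (\<lambda>X Y. q (inf (r X) (r Y))), lunit = q u\<rparr>"
  have ops: "q x \<otimes>\<^bsub>K\<^esub> q y = q (x + y)" "join K (q x) (q y) = q (sup x y)"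
    "meet K (q x) (q y) = q (inf x y)" "carrier K = range q" "\<one>\<^bsub>K\<^esub> = q 0" "lunit K = q u" for x y
    by (simp_all add: K_def qadd qsup qinf)
  have cg: "comm_group K"
  proof (rule comm_groupI)
    fix X assume "X \<in> carrier K"
    then obtain x where "X = q x" by (auto simp: ops)
    then show "\<exists>Y\<in>carrier K. Y \<otimes>\<^bsub>K\<^esub> X = \<one>\<^bsub>K\<^esub>"
      by (intro bexI[of _ "q (- x)"]) (simp_all add: ops)
  qed (auto simp: ops ac_simps)
  have pw: "q x [^]\<^bsub>K\<^esub> (n::nat) = q (int n \<odot> x)" for x n
    unfolding int_pow_int
    by (induction n) (simp_all add: additive_group_def nat_pow_def ops)
  have "\<exists>n::nat. n \<ge> 1 \<and> join K (q x) (q u [^]\<^bsub>K\<^esub> n) = q u [^]\<^bsub>K\<^esub> n" for x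
    using u unfolding order_unit_def pw ops by (metis sup_absorb2)
  then have "unital_lgroup K"
    unfolding unital_lgroup_def using cg
    by (simp add: ops ac_simps add_sup_distrib_left)
  moreover have "q \<in> unital_lhom (lgroup_of u) K"
    by (auto simp: unital_lhom_def lgroup_of_def hom_def ops)
  moreover have "I = kernel (lgroup_of u) K q"
    by (auto simp: kernel_def ops qeq lgroup_of_def)
  ultimately show "l_ideal u I" unfolding l_ideal_def by blast
qed

section \<open>States\<close>

definition states :: "'a::lattice_ab_group_add \<Rightarrow> ('a \<Rightarrow> real) set" where
  "states u = {h. (\<forall>x y. h (x + y) = h x + h y) \<and> (\<forall>x y. h (sup x y) = max (h x) (h y)) \<and> h u = 1}"

lemma statesD:
  assumes "h \<in> states u"
  shows state_add: "h (x + y) = h x + h y"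
    and state_sup: "h (sup x y) = max (h x) (h y)"
    and state_unit: "h u = 1"
    and state_zero: "h 0 = 0"
    and state_minus: "h (- x) = - h x"
    and state_diff: "h (x - y) = h x - h y"
    and state_inf: "h (inf x y) = min (h x) (h y)"
    and state_pprt: "h (pprt x) = max (h x) 0"
proof -
  show add: "h (x + y) = h x + h y" and sup: "h (sup x y) = max (h x) (h y)" and "h u = 1" for x y
    using assms by (auto simp: states_def)
  show 0: "h 0 = 0" using add[of 0 0] by simp
  show minus: "h (- x) = - h x" for x using add[of x "- x"] 0 by simp
  show "h (x - y) = h x - h y" using add[of x "- y"] minus by simp
  show "h (inf x y) = min (h x) (h y)" by (simp only: inf_eq_neg_sup minus sup min_def max_def) simp
  show "h (pprt x) = max (h x) 0" by (simp add: pprt_def sup 0)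
qed

lemma state_zmult:
  assumes h: "h \<in> states u"
  shows "h (k \<odot> x) = of_int k * h x"
proof (induction k rule: int_induct[of _ 0])
  case base then show ?case using state_zero[OF h] by simp
next
  case (step1 i) then show ?case by (simp add: zmult_add_left state_add[OF h] algebra_simps)
next
  case (step2 i) then show ?case by (simp add: zmult_diff_left state_diff[OF h] algebra_simps)
qed

lemma state_sum: "h \<in> states u \<Longrightarrow> h (\<Sum>i\<in>I. f i) = (\<Sum>i\<in>I. h (f i))"
  by (induction I rule: infinite_finite_induct) (simp_all add: state_zero state_add)

lemma state_nonneg: "h \<in> states u \<Longrightarrow> 0 \<le> x \<Longrightarrow> 0 \<le> h x"
  using state_pprt[of h u x] by simp

lemma state_mono: "h \<in> states u \<Longrightarrow> x \<le> y \<Longrightarrow> h x \<le> h y"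
  using state_nonneg[of h u "y - x"] state_diff[of h u y x] by simp

lemma convex_lsubgroup_eq_UNIV:
  fixes u :: "'a::lattice_ab_group_add"
  assumes u: "order_unit u" and I: "convex_lsubgroup I" and "u \<in> I"
  shows "I = UNIV"
proof -
  have "x \<in> I" for x
  proof -
    obtain m n :: nat where "x \<le> int m \<odot> u" "- x \<le> int n \<odot> u" using u unfolding order_unit_def by blast
    then show ?thesis
      using convex_lsubgroup_sandwich[OF I] convex_lsubgroup_zmult[OF I \<open>u \<in> I\<close>] by blast
  qed
  then show ?thesis by blast
qed

text \<open>
  If a larger ideal contains \<open>a \<ge> 0\<close> with \<open>h a > 0\<close>, then some \<open>u - n a\<close> has negative value, so its
  positive part is in the kernel; hence \<open>u\<close> is below an element of the larger ideal.
\<close>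
lemma state_kernel_MaxSpec:
  fixes u :: "'a::lattice_ab_group_add"
  assumes u: "order_unit u" and h: "h \<in> states u"
  shows "{x. h x = 0} \<in> MaxSpec u"
proof -
  note hs = statesD[OF h]
  have "convex_lsubgroup {x. h x = 0}"
    unfolding convex_lsubgroup_def
    using state_nonneg[OF h] state_mono[OF h] by (auto simp: hs) (metis antisym)
  moreover have "{x. h x = 0} \<noteq> UNIV" using hs(3) by (metis UNIV_I mem_Collect_eq zero_neq_one)
  moreover have "J = {x. h x = 0}"
    if J: "convex_lsubgroup J" and "J \<noteq> UNIV" and sub: "{x. h x = 0} \<subseteq> J" for J
  proof (rule ccontr)
    assume "J \<noteq> {x. h x = 0}"
    then obtain g where g: "g \<in> J" "h g \<noteq> 0" using sub by blast
    define a where "a = pprt g + pprt (- g)"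
    have aJ: "a \<in> J" using convex_lsubgroupD[OF J] g(1) unfolding a_def by blast
    have "h a > 0" using g(2) unfolding a_def by (simp add: hs)
    then obtain n :: nat where n: "1 < real n * h a" using ex_less_of_nat_mult by blast
    have "h (pprt (u - int n \<odot> a)) = 0" using n by (simp add: hs state_zmult[OF h])
    then have "pprt (u - int n \<odot> a) \<in> J" using sub by blast
    then have "pprt (u - int n \<odot> a) + int n \<odot> a \<in> J"
      using convex_lsubgroup_zmult[OF J aJ] convex_lsubgroupD(2)[OF J] by blast
    moreover have "u \<le> pprt (u - int n \<odot> a) + int n \<odot> a"
      by (simp add: pprt_def flip: diff_le_eq)
    ultimately have "u \<in> J"
      using convex_lsubgroupD(6)[OF J order_unit_nonneg[OF u]] by blast
    then show False using convex_lsubgroup_eq_UNIV[OF u J] \<open>J \<noteq> UNIV\<close> by blast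
  qed
  ultimately show ?thesis
    using l_ideal_iff_convex_lsubgroup[OF u] unfolding MaxSpec_def by auto
qed

lemma MaxSpecD:
  assumes u: "order_unit u" and M: "M \<in> MaxSpec u"
  shows "convex_lsubgroup M" "u \<notin> M"
    "convex_lsubgroup J \<Longrightarrow> u \<notin> J \<Longrightarrow> M \<subseteq> J \<Longrightarrow> J = M"
  using M convex_lsubgroup_eq_UNIV[OF u] unfolding MaxSpec_def l_ideal_iff_convex_lsubgroup[OF u]
  by blast+

text \<open>
  If \<open>a\<close> is not in \<open>M\<close>, then \<open>M\<close> and \<open>a\<close> generate everything, so \<open>u \<le> x + n a\<close> with \<open>x \<in> M\<close>, and
  likewise for \<open>b\<close>. As multiples of \<open>a\<close> and \<open>b\<close> are disjoint, meeting the two bounds puts \<open>u\<close> below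
  an element of \<open>M\<close>.
\<close>
lemma MaxSpec_prime:
  fixes u :: "'a::lattice_ab_group_add"
  assumes u: "order_unit u" and M: "M \<in> MaxSpec u"
    and a: "0 \<le> a" and b: "0 \<le> b" and ab: "inf a b = 0"
  shows "a \<in> M \<or> b \<in> M"
proof (rule ccontr)
  assume neg: "\<not> (a \<in> M \<or> b \<in> M)"
  note MD = convex_lsubgroupD[OF MaxSpecD(1)[OF u M]]
  have bound: "\<exists>m\<in>M. 0 \<le> m \<and> (\<exists>n::nat. u \<le> m + int n \<odot> a)" if a: "0 \<le> a" "a \<notin> M" for a
  proof (rule ccontr)
    assume no: "\<not> ?thesis"
    define J where "J = {x. \<exists>m\<in>M. 0 \<le> m \<and> (\<exists>n::nat. x \<le> m + int n \<odot> a \<and> - x \<le> m + int n \<odot> a)}"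
    have JI: "x \<in> J" if "m \<in> M" "0 \<le> m" "x \<le> m + int n \<odot> a" "- x \<le> m + int n \<odot> a" for x m n
      using that unfolding J_def by blast
    have JE: "\<exists>m n. m \<in> M \<and> 0 \<le> m \<and> x \<le> m + int n \<odot> a \<and> - x \<le> m + int n \<odot> a" if "x \<in> J" for x
      using that unfolding J_def by blast
    have na: "0 \<le> int n \<odot> a" for n using a(1) by (simp add: zmult_nonneg)
    have "convex_lsubgroup J"
      unfolding convex_lsubgroup_def
    proof (intro conjI ballI allI impI)
      show "0 \<in> J" by (rule JI[of 0 _ 0]) (simp_all add: MD)
    next
      fix x y assume "x \<in> J" "y \<in> J"
      then obtain m n m' n' where m: "m \<in> M" "0 \<le> m" "x \<le> m + int n \<odot> a" "- x \<le> m + int n \<odot> a"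
        "m' \<in> M" "0 \<le> m'" "y \<le> m' + int n' \<odot> a" "- y \<le> m' + int n' \<odot> a" by (metis JE)
      show "x + y \<in> J"
      proof (rule JI[of "m + m'" _ "n + n'"])
        show "x + y \<le> m + m' + int (n + n') \<odot> a"
          using add_mono[OF m(3,7)] by (simp add: zmult_add_left algebra_simps)
        show "- (x + y) \<le> m + m' + int (n + n') \<odot> a"
          using add_mono[OF m(4,8)] by (simp add: zmult_add_left algebra_simps)
      qed (use m MD in auto)
    next
      fix x assume "x \<in> J" then show "- x \<in> J" by (metis JE JI minus_minus)
    next
      fix x assume "x \<in> J"
      then obtain m n where m: "m \<in> M" "0 \<le> m" "x \<le> m + int n \<odot> a" by (metis JE)
      have "0 \<le> m + int n \<odot> a" using m(2) na by (rule add_nonneg_nonneg)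
      moreover have "- pprt x \<le> 0" by simp
      ultimately show "pprt x \<in> J"
        using m by (intro JI[OF m(1,2), of _ n]) (simp add: pprt_def, blast intro: order_trans)
    next
      fix x y assume "y \<in> J" and xy: "0 \<le> x \<and> x \<le> y"
      then obtain m n where m: "m \<in> M" "0 \<le> m" "y \<le> m + int n \<odot> a" by (metis JE)
      have "0 \<le> m + int n \<odot> a" using m(2) na by (rule add_nonneg_nonneg)
      moreover have "- x \<le> 0" using xy by simp
      ultimately show "x \<in> J" using xy m by (intro JI[OF m(1,2), of _ n]) (blast intro: order_trans)+
    qed
    moreover have "u \<notin> J" using no JE by meson
    moreover have "M \<subseteq> J"
    proof
      fix x assume "x \<in> M"
      have "pprt x + pprt (- x) \<in> M" "0 \<le> pprt x + pprt (- x)" using MD \<open>x \<in> M\<close> by simp_all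
      moreover have "x \<le> pprt x + pprt (- x)" "- x \<le> pprt x + pprt (- x)"
        by (simp_all add: pprt_def add_increasing add_increasing2)
      ultimately show "x \<in> J" by (intro JI[of "pprt x + pprt (- x)" _ 0]) auto
    qed
    moreover have "- a \<le> a" using a(1) by (meson neg_le_0_iff_le order_trans)
    then have "a \<in> J" by (intro JI[of 0 _ 1]) (auto simp: MD)
    ultimately show False using MaxSpecD(3)[OF u M] a(2) by blast
  qed
  obtain m n m' n' where m: "m \<in> M" "0 \<le> m" "u \<le> m + int n \<odot> a" "m' \<in> M" "0 \<le> m'" "u \<le> m' + int n' \<odot> b"
    using bound[OF a] bound[OF b] neg by blast
  have "inf (int n \<odot> a) (int n' \<odot> b) = 0"
    using a b ab by (metis inf_commute inf_zmult_eq_zero of_nat_0_le_iff zmult_nonneg)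
  moreover have "u \<le> (m + m') + int n \<odot> a" "u \<le> (m + m') + int n' \<odot> b"
    using m add_increasing[OF m(5) m(3)] add_increasing[OF m(2) m(6)] by (simp_all add: ac_simps)
  ultimately have "u \<le> m + m'" by (metis add.right_neutral add_inf_distrib_left le_inf_iff)
  then have "u \<in> M" using MD(6)[OF order_unit_nonneg[OF u]] MD(2)[OF m(1,4)] by blast
  then show False using MaxSpecD(2)[OF u M] by blast
qed

lemma rational_between:
  fixes a b :: real
  assumes "a < b"
  obtains p q :: int where "1 \<le> q" "a < of_int p / of_int q" "of_int p / of_int q < b"
proof -
  obtain r where r: "a < of_rat r" "of_rat r < b" using of_rat_dense[OF assms] by blast
  obtain p q where "quotient_of r = (p, q)" by fastforce
  then have "r = of_int p / of_int q" "q > 0" by (simp_all add: quotient_of_div quotient_of_denom_pos)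
  then show ?thesis using that[of q p] r by (simp add: of_rat_divide)
qed

text \<open>
  Hoelder's theorem for the quotient by \<open>M\<close>, which is totally ordered because \<open>M\<close> is prime. The value
  of \<open>g\<close> is the infimum of the fractions \<open>p/q\<close> with \<open>q g \<le> p u\<close> modulo \<open>M\<close>. Subadditivity is
  immediate, and totality of the order turns it into additivity. The kernel of the resulting state
  contains \<open>M\<close>, so it is \<open>M\<close> by maximality.
\<close>
lemma MaxSpec_eq_state_kernel:
  fixes u :: "'a::lattice_ab_group_add"
  assumes u: "order_unit u" and M: "M \<in> MaxSpec u"
  obtains h where "h \<in> states u" "M = {x. h x = 0}"
proof -
  have MI: "convex_lsubgroup M" and uM: "u \<notin> M" using MaxSpecD(1,2)[OF u M] by blast+
  note MD = convex_lsubgroupD[OF MI]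
  define le where "le x y \<longleftrightarrow> pprt (x - y) \<in> M" for x y
  have le_of_le: "le x y" if "x \<le> y" for x y using that MD(1) by (simp add: le_def)
  have le_total: "le x y \<or> le y x" for x y
    using MaxSpec_prime[OF u M zero_le_pprt zero_le_pprt inf_pprt_pprt_minus[of "x - y"]]
    by (simp add: le_def)
  have pprt_add: "pprt (x + y) \<le> pprt x + pprt y" for x y :: 'a
    by (simp add: pprt_def add_mono)
  have le_add: "le (x + x') (y + y')" if "le x y" "le x' y'" for x x' y y'
  proof -
    have "pprt (x + x' - (y + y')) \<le> pprt (x - y) + pprt (x' - y')"
      using pprt_add[of "x - y" "x' - y'"] by (simp add: algebra_simps)
    then show ?thesis using that MD(2,6) zero_le_pprt unfolding le_def by meson
  qed
  have le_trans: "le x z" if "le x y" "le y z" for x y z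
    using le_add[OF that] by (simp add: le_def add.commute)
  have le_zmult: "le (k \<odot> x) (k \<odot> y)" if "0 \<le> k" "le x y" for k x y
  proof -
    have "pprt (k \<odot> (x - y)) \<le> k \<odot> pprt (x - y)"
      using that(1) zmult_nonneg[OF that(1) zero_le_pprt] zmult_mono_right[OF that(1), of "x - y" "pprt (x - y)"]
      by (simp add: pprt_def)
    then show ?thesis
      using that(2) convex_lsubgroup_zmult[OF MI] MD(6) zero_le_pprt
      unfolding le_def by (metis zmult_diff_right)
  qed
  have le_unit: "k \<le> l" if le: "le (k \<odot> u) (l \<odot> u)" for k l
  proof (rule ccontr)
    assume "\<not> k \<le> l"
    then have "1 \<odot> u \<le> (k - l) \<odot> u" "0 \<le> (k - l) \<odot> u"
      using order_unit_nonneg[OF u] by (intro zmult_mono_left zmult_nonneg; simp)+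
    then show False
      using le MD(6)[OF order_unit_nonneg[OF u]] uM by (simp add: le_def zmult_diff_left)
  qed
  (* upper bounds for the value of g in the quotient *)
  define U :: "'a \<Rightarrow> real set" where
    "U g = {of_int p / of_int q | p q. 1 \<le> q \<and> le (q \<odot> g) (p \<odot> u)}" for g
  define h where "h g = Inf (U g)" for g
  have UI: "of_int p / of_int q \<in> U g" if "1 \<le> q" "le (q \<odot> g) (p \<odot> u)" for p q g
    using that unfolding U_def by blast
  have lower: "\<exists>c. \<forall>r\<in>U g. c \<le> r" for g
  proof -
    obtain n :: nat where n: "- g \<le> int n \<odot> u" using u unfolding order_unit_def by blast
    have "- real n \<le> r" if "r \<in> U g" for r
    proof -
      obtain p q where r: "r = of_int p / of_int q" "1 \<le> q" "le (q \<odot> g) (p \<odot> u)"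
        using \<open>r \<in> U g\<close> unfolding U_def by blast
      have "le (- int n \<odot> u) g" using n le_of_le by (simp add: zmult_minus_left minus_le_iff)
      then have "le (q \<odot> (- int n) \<odot> u) (q \<odot> g)" using r(2) by (intro le_zmult) simp
      then have "le (q \<odot> (- int n) \<odot> u) (p \<odot> u)" using r(3) by (rule le_trans)
      then have "q * - int n \<le> p" by (intro le_unit) (simp only: zmult_zmult)
      then have "of_int q * - real n \<le> of_int p" by (metis of_int_le_iff of_int_minus of_int_mult of_int_of_nat_eq)
      then show ?thesis unfolding r(1) using r(2) by (simp add: pos_le_divide_eq mult.commute)
    qed
    then show ?thesis by blast
  qed
  have bdd: "bdd_below (U g)" for g using lower[of g] by (auto simp: bdd_below_def)
  have ne: "U g \<noteq> {}" for g
  proof -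
    obtain n :: nat where "g \<le> int n \<odot> u" using u unfolding order_unit_def by blast
    then show ?thesis using UI[of 1 g "int n"] le_of_le by force
  qed
  have h_le: "h g \<le> r" if "r \<in> U g" for g r
    unfolding h_def using that bdd by (rule cInf_lower)
  have sub: "h (g + g') \<le> h g + h g'" for g g'
  proof -
    have "h (g + g') \<le> r + s" if "r \<in> U g" "s \<in> U g'" for r s
    proof -
      obtain p q p' q' where r: "r = of_int p / of_int q" "1 \<le> q" "le (q \<odot> g) (p \<odot> u)"
        and s: "s = of_int p' / of_int q'" "1 \<le> q'" "le (q' \<odot> g') (p' \<odot> u)"
        using \<open>r \<in> U g\<close> \<open>s \<in> U g'\<close> unfolding U_def by blast
      have "le (q' \<odot> q \<odot> g + q \<odot> q' \<odot> g') (q' \<odot> p \<odot> u + q \<odot> p' \<odot> u)"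
        using r(2,3) s(2,3) by (intro le_add le_zmult) auto
      then have "le ((q * q') \<odot> (g + g')) ((q' * p + q * p') \<odot> u)"
        by (simp add: zmult_zmult zmult_add_left zmult_add_right mult.commute)
      then have "of_int (q' * p + q * p') / of_int (q * q') \<in> U (g + g')"
        using r(2) s(2) mult_mono[of 1 q 1 q'] by (intro UI) simp_all
      moreover have "of_int (q' * p + q * p') / of_int (q * q') = r + s"
        using r(1,2) s(1,2) by (simp add: field_simps)
      ultimately show ?thesis using h_le by metis
    qed
    then have "h (g + g') - s \<le> h g" if "s \<in> U g'" for s
      unfolding h_def[of g] using that by (intro cInf_greatest ne) (simp add: diff_le_eq)
    then have "h (g + g') - h g \<le> h g'"
      unfolding h_def[of g'] by (intro cInf_greatest ne) (simp add: algebra_simps)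
    then show ?thesis by simp
  qed
  have h0: "h 0 = 0"
  proof (rule antisym)
    show "h 0 \<le> 0" using h_le UI[of 1 0 0] le_of_le by simp
    have "0 \<le> r" if "r \<in> U 0" for r
    proof -
      obtain p q where r: "r = of_int p / of_int q" "1 \<le> q" "le (q \<odot> 0) (p \<odot> u)"
        using \<open>r \<in> U 0\<close> unfolding U_def by blast
      then have "0 \<le> p" using le_unit[of 0 p] by simp
      then show ?thesis using r by simp
    qed
    then show "0 \<le> h 0" unfolding h_def by (intro cInf_greatest ne)
  qed
  have hneg: "h (- g) \<le> - h g" for g
  proof (rule ccontr)
    assume "\<not> ?thesis"
    then obtain p q :: int where q: "1 \<le> q" and pq: "- h (- g) < of_int p / of_int q" "of_int p / of_int q < h g"
      using rational_between[of "- h (- g)" "h g"] by (metis linorder_not_le minus_less_iff)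
    have "\<not> le (q \<odot> g) (p \<odot> u)" using h_le[OF UI[OF q]] pq(2) by fastforce
    then have "le (p \<odot> u) (q \<odot> g)" using le_total by blast
    then have "le (q \<odot> (- g)) ((- p) \<odot> u)"
      by (simp add: le_def zmult_minus_left zmult_minus_right add.commute)
    then have "h (- g) \<le> of_int (- p) / of_int q" using h_le UI[OF q] by blast
    then show False using pq(1) by simp
  qed
  have hadd: "h (g + g') = h g + h g'" for g g'
    using sub[of g g'] sub[of "g + g'" "- g'"] hneg[of g'] by simp
  have hnonpos: "h g \<le> 0" if "pprt g \<in> M" for g
    using h_le[OF UI[of 1 g 0]] that by (simp add: le_def)
  have hM: "h m = 0" if "m \<in> M" for m
    using hnonpos[of m] hnonpos[of "- m"] hadd[of m "- m"] h0 MD(3,4) that by simp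
  have hsup_le: "h (sup x y) = max (h x) (h y)" if "le x y" for x y
  proof -
    have "sup x y = pprt (x - y) + y" by (simp add: pprt_def add_sup_distrib_right)
    then have "h (sup x y) = h y" using hadd hM that by (simp add: le_def)
    moreover have "h x \<le> h y" using hadd[of "x - y" y] hnonpos[of "x - y"] that by (simp add: le_def)
    ultimately show ?thesis by simp
  qed
  have hsup: "h (sup x y) = max (h x) (h y)" for x y
    using le_total[of x y] hsup_le[of x y] hsup_le[of y x] by (auto simp: sup_commute max.commute)
  have "h u = 1"
  proof (rule antisym)
    show "h u \<le> 1" using h_le UI[of 1 u 1] le_of_le by simp
    have "1 \<le> r" if "r \<in> U u" for r
    proof -
      obtain p q where r: "r = of_int p / of_int q" "1 \<le> q" "le (q \<odot> u) (p \<odot> u)"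
        using \<open>r \<in> U u\<close> unfolding U_def by blast
      then have "q \<le> p" using le_unit by simp
      then show ?thesis using r by simp
    qed
    then show "1 \<le> h u" unfolding h_def by (intro cInf_greatest ne)
  qed
  then have h: "h \<in> states u" using hadd hsup by (simp add: states_def)
  have K: "{x. h x = 0} \<in> MaxSpec u" by (rule state_kernel_MaxSpec[OF u h])
  have "M = {x. h x = 0}"
    using MaxSpecD(3)[OF u M MaxSpecD(1,2)[OF u K]] hM by blast
  with h show ?thesis using that by blast
qed

text \<open>
  Two different values at \<open>a\<close> are separated by a fraction \<open>p/q\<close>, and then the positive part of
  \<open>q a - p u\<close> is in one kernel only.
\<close>
lemma state_kernel_inj:
  assumes h: "h \<in> states u" and h': "h' \<in> states u" and eq: "{x. h x = 0} = {x. h' x = 0}"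
  shows "h = h'"
proof -
  have "h' a \<le> h a" if "h \<in> states u" "h' \<in> states u" "{x. h x = 0} = {x. h' x = 0}" for h h' a
  proof (rule ccontr)
    assume "\<not> h' a \<le> h a"
    then obtain p q :: int where q: "1 \<le> q" "h a < of_int p / of_int q" "of_int p / of_int q < h' a"
      using rational_between[of "h a" "h' a"] by (metis linorder_not_le)
    define g where "g = pprt (q \<odot> a - p \<odot> u)"
    have "h g = 0" "h' g > 0"
      using q by (simp_all add: g_def statesD[OF that(1)] statesD[OF that(2)] state_zmult[OF that(1)]
          state_zmult[OF that(2)] field_simps max_def)
    then show False using that(3) by (metis (mono_tags, lifting) mem_Collect_eq less_irrefl)
  qed
  then have "h a = h' a" for a using assms by (metis antisym)
  then show ?thesis by blast
qed

text \<open>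
  The condition \<open>h a \<noteq> 0\<close> is open for pointwise convergence. Conversely, \<open>c < h a\<close> holds if and only if
  \<open>h\<close> is nonzero on the positive part of \<open>q a - p u\<close> for some fraction \<open>p/q > c\<close>, which is a union
  of basic open sets of the spectral topology.
\<close>
lemma states_homeomorphic_MaxSpec:
  fixes u :: "'a::lattice_ab_group_add"
  assumes u: "order_unit u"
  shows "homeomorphic_map (subtopology (powertop_real UNIV) (states u)) (spectral_topology u) (\<lambda>h. {x. h x = 0})"
proof -
  let ?S = "subtopology (powertop_real UNIV) (states u)"
  let ?\<kappa> = "\<lambda>h. {x::'a. h x = (0::real)}"
  have topS: "topspace ?S = states u" by simp
  have topM: "topspace (spectral_topology u) = MaxSpec u"
    using MaxSpecD(2)[OF u] by (auto simp: spectral_topology_def)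
  define \<sigma> where "\<sigma> M = (SOME h. h \<in> states u \<and> M = {x. h x = 0})" for M
  have \<sigma>: "\<sigma> M \<in> states u" "?\<kappa> (\<sigma> M) = M" if "M \<in> MaxSpec u" for M
  proof -
    have "\<exists>h. h \<in> states u \<and> M = ?\<kappa> h" using MaxSpec_eq_state_kernel[OF u that] by blast
    from someI_ex[OF this] show "\<sigma> M \<in> states u" "?\<kappa> (\<sigma> M) = M" unfolding \<sigma>_def by auto
  qed
  have \<sigma>\<kappa>: "\<sigma> (?\<kappa> h) = h" if "h \<in> states u" for h
    using state_kernel_inj that \<sigma>[OF state_kernel_MaxSpec[OF u that]] by blast
  have proj: "continuous_map ?S euclideanreal (\<lambda>h. h a)" for a
    by (intro continuous_map_from_subtopology continuous_map_product_projection) simp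
  have "continuous_map ?S (spectral_topology u) ?\<kappa>"
    unfolding spectral_topology_def
  proof (rule continuous_on_generated_topo)
    fix V assume "V \<in> range (\<lambda>a. MaxSpec u - {M \<in> MaxSpec u. a \<in> M})"
    then obtain a where V: "V = MaxSpec u - {M \<in> MaxSpec u. a \<in> M}" by blast
    have "?\<kappa> -` V \<inter> topspace ?S = {h \<in> topspace ?S. h a \<in> - {0}}"
      using state_kernel_MaxSpec[OF u] by (auto simp: V)
    also have "openin ?S \<dots>" by (rule openin_continuous_map_preimage[OF proj]) (simp add: open_Compl)
    finally show "openin ?S (?\<kappa> -` V \<inter> topspace ?S)" .
  next
    show "?\<kappa> ` topspace ?S \<subseteq> \<Union> (range (\<lambda>a. MaxSpec u - {M \<in> MaxSpec u. a \<in> M}))"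
      using state_kernel_MaxSpec[OF u] MaxSpecD(2)[OF u] by fastforce
  qed
  moreover have "continuous_map (spectral_topology u) ?S \<sigma>"
    unfolding continuous_map_in_subtopology continuous_map_componentwise_UNIV
  proof (intro conjI allI)
    show "\<sigma> \<in> topspace (spectral_topology u) \<rightarrow> states u" using \<sigma>(1) by (simp add: topM)
    fix a
    have basic: "openin (spectral_topology u) {M \<in> MaxSpec u. g \<notin> M}" for g
      unfolding spectral_topology_def by (rule topology_generated_by_Basis) auto
    have gt: "openin (spectral_topology u) {M \<in> MaxSpec u. c < \<sigma> M a}" for c a
    proof -
      have mem: "pprt (q \<odot> a - p \<odot> u) \<notin> M \<longleftrightarrow> of_int p / of_int q < \<sigma> M a"
        if "1 \<le> q" "M \<in> MaxSpec u" for p q M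
      proof -
        have "pprt (q \<odot> a - p \<odot> u) \<in> M \<longleftrightarrow> \<sigma> M (pprt (q \<odot> a - p \<odot> u)) = 0"
          using \<sigma>(2)[OF that(2)] by blast
        then show ?thesis
          using that(1) \<sigma>(1)[OF that(2)]
          by (auto simp: statesD[OF \<sigma>(1)[OF that(2)]] state_zmult[OF \<sigma>(1)[OF that(2)]] field_simps max_def)
      qed
      have "{M \<in> MaxSpec u. c < \<sigma> M a} =
        (\<Union>(p, q)\<in>{(p, q). 1 \<le> q \<and> c < of_int p / of_int q}. {M \<in> MaxSpec u. pprt (q \<odot> a - p \<odot> u) \<notin> M})"
        (is "?L = ?R")
      proof
        show "?L \<subseteq> ?R"
        proof
          fix M assume M: "M \<in> ?L"
          then obtain p q :: int where "1 \<le> q" "c < of_int p / of_int q" "of_int p / of_int q < \<sigma> M a"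
            using rational_between[of c "\<sigma> M a"] by blast
          then show "M \<in> ?R" using M mem by blast
        qed
        show "?R \<subseteq> ?L" using mem by fastforce
      qed
      also have "openin (spectral_topology u) \<dots>"
        by (rule openin_Union) (auto simp: basic)
      finally show ?thesis .
    qed
    have "\<sigma> M (- a) = - \<sigma> M a" if "M \<in> MaxSpec u" for M using state_minus[OF \<sigma>(1)[OF that]] .
    then have "{M \<in> MaxSpec u. \<sigma> M a < c} = {M \<in> MaxSpec u. - c < \<sigma> M (- a)}" for c by auto
    then show "continuous_map (spectral_topology u) euclideanreal (\<lambda>M. \<sigma> M a)"
      unfolding continuous_map_upper_lower_semicontinuous_lt topM using gt by simp
  qed
  ultimately have "homeomorphic_maps ?S (spectral_topology u) ?\<kappa> \<sigma>"
    unfolding homeomorphic_maps_def topS topM using \<sigma>(2) \<sigma>\<kappa> by blast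
  then show ?thesis using homeomorphic_map_maps by blast
qed

lemma face_of_MaxSpec_homeomorphic_states:
  fixes u :: "'a::lattice_ab_group_add"
  assumes u: "order_unit u"
  shows "subtopology (powertop_real UNIV) {h \<in> states u. \<forall>b\<in>D. h b = 0} homeomorphic_space
    subtopology (spectral_topology u) {M \<in> MaxSpec u. D \<subseteq> M}"
proof -
  have "homeomorphic_map (subtopology (subtopology (powertop_real UNIV) (states u)) {h. \<forall>b\<in>D. h b = 0})
    (subtopology (spectral_topology u) {M \<in> MaxSpec u. D \<subseteq> M}) (\<lambda>h. {x. h x = 0})"
    using state_kernel_MaxSpec[OF u]
    by (intro homeomorphic_map_subtopologies_alt[OF states_homeomorphic_MaxSpec[OF u]]) auto
  from homeomorphic_map_imp_homeomorphic_space[OF this] show ?thesis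
    by (simp only: subtopology_subtopology Collect_conj_eq Collect_mem_eq)
qed

section \<open>Faces\<close>

text \<open>The conditions on a basis other than the topological one, with chosen multiplicities.\<close>
locale positive_generators =
  fixes u :: "'a::lattice_ab_group_add" and B :: "'a set" and m :: "'a \<Rightarrow> int"
  assumes finite_B: "finite B" and B_nonempty: "B \<noteq> {}"
    and pos: "b \<in> B \<Longrightarrow> 0 \<le> b" and nonzero: "b \<in> B \<Longrightarrow> b \<noteq> 0"
    and generates: "l_generated B = UNIV"
    and mult_ge_1: "b \<in> B \<Longrightarrow> 1 \<le> m b"
    and unit_eq: "(\<Sum>b\<in>B. m b \<odot> b) = u"
begin

text \<open>
  The geometric simplex on \<open>C\<close>: nonnegative values on the generators, zero outside \<open>C\<close>, for which
  the combination representing \<open>u\<close> has value \<open>1\<close>.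
\<close>
definition weights :: "'a set \<Rightarrow> ('a \<Rightarrow> real) set" where
  "weights C = {x. (\<forall>b. 0 \<le> x b) \<and> (\<forall>b. b \<notin> C \<longrightarrow> x b = 0) \<and> (\<Sum>b\<in>B. of_int (m b) * x b) = 1}"

definition face :: "'a set \<Rightarrow> ('a \<Rightarrow> real) set" where
  "face C = {h \<in> states u. \<forall>b\<in>B - C. h b = 0}"

text \<open>Barycentric coordinates of a state, when \<open>e\<close> enumerates the vertices of a face containing it.\<close>
definition coord :: "(nat \<Rightarrow> 'a) \<Rightarrow> nat \<Rightarrow> ('a \<Rightarrow> real) \<Rightarrow> nat \<Rightarrow> real" where
  "coord e p h = (\<lambda>i. if i \<le> p then of_int (m (e i)) * h (e i) else 0)"

lemma state_weights_sum:
  assumes "h \<in> states u"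
  shows "(\<Sum>b\<in>B. of_int (m b) * h b) = 1"
  using state_unit[OF assms] state_sum[OF assms, of "\<lambda>b. m b \<odot> b" B] unit_eq
  by (simp add: state_zmult[OF assms])

lemma sum_support:
  fixes x :: "'a \<Rightarrow> real"
  assumes "C \<subseteq> B" "\<And>b. b \<in> B - C \<Longrightarrow> x b = 0" "bij_betw e {..p} C"
  shows "(\<Sum>b\<in>B. of_int (m b) * x b) = (\<Sum>i\<le>p. of_int (m (e i)) * x (e i))"
proof -
  have "(\<Sum>b\<in>B. of_int (m b) * x b) = (\<Sum>b\<in>C. of_int (m b) * x b)"
    using assms(1,2) finite_B by (intro sum.mono_neutral_right) auto
  also have "\<dots> = (\<Sum>i\<le>p. of_int (m (e i)) * x (e i))"
    using assms(3) by (rule sum.reindex_bij_betw[symmetric])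
  finally show ?thesis .
qed

lemma coord_in_standard_simplex:
  assumes C: "C \<subseteq> B" and e: "bij_betw e {..p} C" and h: "h \<in> face C"
  shows "coord e p h \<in> standard_simplex p"
proof (rule standard_simplexI)
  have hs: "h \<in> states u" using h by (simp add: face_def)
  have eB: "e i \<in> B" if "i \<le> p" for i using that e C by (auto simp: bij_betw_def)
  show "0 \<le> coord e p h i" if "i \<le> p" for i
    using mult_ge_1[OF eB[OF that]] state_nonneg[OF hs pos[OF eB[OF that]]] by (simp add: coord_def)
  show "coord e p h i = 0" if "p < i" for i using that by (simp add: coord_def)
  have "(\<Sum>i\<le>p. coord e p h i) = (\<Sum>b\<in>B. of_int (m b) * h b)"
    using sum_support[OF C _ e, of h] h by (simp add: coord_def face_def)
  then show "(\<Sum>i\<le>p. coord e p h i) = 1" using state_weights_sum[OF hs] by simp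
qed

text \<open>
  Every element is an l-group term in the generators, so the value of a state at this element is a
  continuous, piecewise linear function of its values on the generators. Hence the coordinates
  determine the state, and they do so continuously.
\<close>
lemma state_eq_continuous_coord:
  assumes C: "C \<subseteq> B" and e: "bij_betw e {..p} C"
  shows "\<exists>\<phi>. continuous_map (powertop_real UNIV) euclideanreal \<phi> \<and> (\<forall>h\<in>face C. h a = \<phi> (coord e p h))"
proof -
  have "a \<in> l_generated B" by (simp add: generates)
  then show ?thesis
  proof induction
    case (gen b)
    show ?case
    proof (cases "b \<in> C")
      case True
      then obtain i where i: "i \<le> p" "b = e i" using e by (auto simp: bij_betw_def)
      have "m b \<noteq> 0" using mult_ge_1[OF gen] by simp
      then have "h b = coord e p h i / of_int (m b)" for h using i by (simp add: coord_def)
      moreover have "continuous_map (powertop_real UNIV) euclideanreal (\<lambda>y. y i / of_int (m b))"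
        using \<open>m b \<noteq> 0\<close> by (intro continuous_intros) auto
      ultimately show ?thesis by blast
    next
      case False
      then have "\<forall>h\<in>face C. h b = 0" using gen by (simp add: face_def)
      then show ?thesis by (intro exI[of _ "\<lambda>_. 0"]) simp
    qed
  next
    case zero
    show ?case by (intro exI[of _ "\<lambda>_. 0"]) (auto simp: face_def dest: state_zero)
  next
    case (add x y)
    then obtain f g where "continuous_map (powertop_real UNIV) euclideanreal f" "\<forall>h\<in>face C. h x = f (coord e p h)"
      "continuous_map (powertop_real UNIV) euclideanreal g" "\<forall>h\<in>face C. h y = g (coord e p h)" by blast
    then show ?case
      by (intro exI[of _ "\<lambda>z. f z + g z"]) (auto simp: face_def state_add intro!: continuous_intros)
  next
    case (neg x)
    then obtain f where "continuous_map (powertop_real UNIV) euclideanreal f" "\<forall>h\<in>face C. h x = f (coord e p h)" by blast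
    then show ?case
      by (intro exI[of _ "\<lambda>z. - f z"]) (auto simp: face_def state_minus intro!: continuous_intros)
  next
    case (sup x y)
    then obtain f g where "continuous_map (powertop_real UNIV) euclideanreal f" "\<forall>h\<in>face C. h x = f (coord e p h)"
      "continuous_map (powertop_real UNIV) euclideanreal g" "\<forall>h\<in>face C. h y = g (coord e p h)" by blast
    then show ?case
      by (intro exI[of _ "\<lambda>z. max (f z) (g z)"]) (auto simp: face_def state_sup intro!: continuous_intros)
  next
    case (inf x y)
    then obtain f g where "continuous_map (powertop_real UNIV) euclideanreal f" "\<forall>h\<in>face C. h x = f (coord e p h)"
      "continuous_map (powertop_real UNIV) euclideanreal g" "\<forall>h\<in>face C. h y = g (coord e p h)" by blast
    then show ?case
      by (intro exI[of _ "\<lambda>z. min (f z) (g z)"]) (auto simp: face_def state_inf intro!: continuous_intros)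
  qed
qed

lemma face_homeomorphic_coord:
  assumes C: "C \<subseteq> B" and e: "bij_betw e {..p} C"
  shows "subtopology (powertop_real UNIV) (face C) homeomorphic_space
    subtopology (powertop_real UNIV) (coord e p ` face C)"
proof -
  let ?F = "subtopology (powertop_real UNIV) (face C)"
  let ?T = "subtopology (powertop_real UNIV) (coord e p ` face C)"
  define \<tau> where "\<tau> = inv_into (face C) (coord e p)"
  have inj: "inj_on (coord e p) (face C)"
  proof (rule inj_onI)
    fix h h' assume h: "h \<in> face C" "h' \<in> face C" and eq: "coord e p h = coord e p h'"
    have "h a = h' a" for a using state_eq_continuous_coord[OF C e, of a] h eq by metis
    then show "h = h'" by blast
  qed
  have \<tau>: "\<tau> (coord e p h) = h" if "h \<in> face C" for h
    unfolding \<tau>_def using inj that by (rule inv_into_f_f)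
  have proj: "continuous_map ?F euclideanreal (\<lambda>h. h a)" for a
    by (intro continuous_map_from_subtopology continuous_map_product_projection) simp
  have "continuous_map ?F ?T (coord e p)"
    unfolding continuous_map_in_subtopology continuous_map_componentwise_UNIV
  proof (intro conjI allI)
    fix i show "continuous_map ?F euclideanreal (\<lambda>h. coord e p h i)"
      unfolding coord_def by (cases "i \<le> p") (auto intro!: continuous_intros proj)
  qed auto
  moreover have "continuous_map ?T ?F \<tau>"
    unfolding continuous_map_in_subtopology continuous_map_componentwise_UNIV
  proof (intro conjI allI)
    fix a
    obtain \<phi> where \<phi>: "continuous_map (powertop_real UNIV) euclideanreal \<phi>" "\<forall>h\<in>face C. h a = \<phi> (coord e p h)"
      using state_eq_continuous_coord[OF C e] by blast
    show "continuous_map ?T euclideanreal (\<lambda>y. \<tau> y a)"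
      by (rule continuous_map_eq[OF continuous_map_from_subtopology[OF \<phi>(1)]]) (use \<phi>(2) \<tau> in auto)
  qed (auto simp: \<tau>)
  ultimately have "homeomorphic_maps ?F ?T (coord e p) \<tau>"
    using \<tau> by (auto simp: homeomorphic_maps_def)
  then show ?thesis unfolding homeomorphic_space_def by blast
qed

text \<open>The values on the generators that a state must have if its barycentric coordinates are \<open>y\<close>.\<close>
definition point :: "(nat \<Rightarrow> 'a) \<Rightarrow> nat \<Rightarrow> 'a set \<Rightarrow> (nat \<Rightarrow> real) \<Rightarrow> 'a \<Rightarrow> real" where
  "point e p C y b = (if b \<in> C then y (inv_into {..p} e b) / of_int (m b) else 0)"

lemma point_vertex:
  assumes "C \<subseteq> B" "bij_betw e {..p} C" "i \<le> p"
  shows "of_int (m (e i)) * point e p C y (e i) = y i"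
proof -
  have "e i \<in> C" "inv_into {..p} e (e i) = i" using assms by (auto simp: bij_betw_def)
  moreover have "m (e i) \<noteq> 0" using mult_ge_1[of "e i"] \<open>e i \<in> C\<close> assms(1) by fastforce
  ultimately show ?thesis by (simp add: point_def)
qed

lemma point_in_weights:
  assumes C: "C \<subseteq> B" and e: "bij_betw e {..p} C" and y: "y \<in> standard_simplex p"
  shows "point e p C y \<in> weights C"
proof -
  have "0 \<le> point e p C y b" for b
    using y mult_ge_1[of b] C by (auto simp: point_def standard_simplex_def intro!: divide_nonneg_nonneg)
  moreover have "(\<Sum>b\<in>B. of_int (m b) * point e p C y b) = 1"
    using sum_support[OF C _ e, of "point e p C y"] point_vertex[OF C e] y
    by (simp add: point_def standard_simplex_def)
  ultimately show ?thesis by (simp add: weights_def point_def)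
qed

lemma coord_eq_of_point:
  assumes C: "C \<subseteq> B" and e: "bij_betw e {..p} C" and y: "y \<in> standard_simplex p"
    and h: "h \<in> states u" "\<And>b. b \<in> B \<Longrightarrow> h b = point e p C y b"
  shows "y \<in> coord e p ` face C"
proof
  show "h \<in> face C" using h by (simp add: face_def point_def)
  show "y = coord e p h"
  proof
    fix i
    have "e i \<in> B" if "i \<le> p" using that e C by (auto simp: bij_betw_def)
    then show "y i = coord e p h i"
      using point_vertex[OF C e, of i y] h(2)[of "e i"] y by (auto simp: coord_def standard_simplex_def)
  qed
qed

lemma weights_realized_iff:
  assumes C: "C \<subseteq> B" and e: "bij_betw e {..p} C"
  shows "(\<forall>x\<in>weights C. \<exists>h\<in>states u. \<forall>b\<in>B. h b = x b) \<longleftrightarrow> coord e p ` face C = standard_simplex p"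
proof
  assume real: "\<forall>x\<in>weights C. \<exists>h\<in>states u. \<forall>b\<in>B. h b = x b"
  then have "y \<in> coord e p ` face C" if "y \<in> standard_simplex p" for y
    using coord_eq_of_point[OF C e that] point_in_weights[OF C e that] by blast
  then show "coord e p ` face C = standard_simplex p"
    using coord_in_standard_simplex[OF C e] by blast
next
  assume eq: "coord e p ` face C = standard_simplex p"
  show "\<forall>x\<in>weights C. \<exists>h\<in>states u. \<forall>b\<in>B. h b = x b"
  proof
    fix x assume x: "x \<in> weights C"
    define y where "y i = (if i \<le> p then of_int (m (e i)) * x (e i) else 0)" for i
    have eB: "e i \<in> B" if "i \<le> p" for i using that e C by (auto simp: bij_betw_def)
    have "y \<in> standard_simplex p"
    proof (rule standard_simplexI)
      show "0 \<le> y i" if "i \<le> p" for i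
        using x mult_ge_1[OF eB[OF that]] by (simp add: y_def weights_def)
      show "(\<Sum>i\<le>p. y i) = 1" using sum_support[OF C _ e, of x] x by (simp add: y_def weights_def)
    qed (simp add: y_def)
    then obtain h where h: "h \<in> face C" "coord e p h = y" using eq by (metis imageE)
    have "h b = x b" if "b \<in> B" for b
    proof (cases "b \<in> C")
      case True
      then obtain i where i: "i \<le> p" "b = e i" using e by (auto simp: bij_betw_def)
      have "of_int (m b) * h b = of_int (m b) * x b"
        using fun_cong[OF h(2), of i] i by (simp add: coord_def y_def)
      then show ?thesis using mult_ge_1[OF that] by simp
    next
      case False
      then show ?thesis using h(1) x that by (simp add: face_def weights_def)
    qed
    then show "\<exists>h\<in>states u. \<forall>b\<in>B. h b = x b" using h(1) by (auto simp: face_def)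
  qed
qed

end

text \<open>
  The algebraic substitute for the topological condition: all points of the simplices that belong to
  sets of generators with nonzero meet are attained by states.
\<close>
locale schauder = positive_generators +
  assumes realizes: "C \<subseteq> B \<Longrightarrow> C \<noteq> {} \<Longrightarrow> Inf_fin C \<noteq> 0 \<Longrightarrow> x \<in> weights C \<Longrightarrow> \<exists>h\<in>states u. \<forall>b\<in>B. h b = x b"

text \<open>
  Induction on the size of \<open>C\<close>. Removing one element of \<open>C\<close> increases the meet, so the proper faces
  are attained by induction hypothesis. Thus the attained points of the face form a set that
  contains the boundary and is contractible, being homeomorphic to a simplex.
\<close>
lemma is_basis_imp_schauder:
  fixes u :: "'a::lattice_ab_group_add"
  assumes u: "order_unit u" and basis: "is_basis u B"
  shows "\<exists>m. schauder u B m"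
proof -
  from basis obtain m :: "'a \<Rightarrow> int" where m: "\<forall>b\<in>B. m b \<ge> 1" "(\<Sum>b\<in>B. m b \<odot> b) = u"
    unfolding is_basis_def by blast
  interpret positive_generators u B m
    using basis m unfolding is_basis_def by unfold_locales auto
  have homeo: "subtopology (spectral_topology u) {M \<in> MaxSpec u. B - C \<subseteq> M} homeomorphic_space
        subtopology (powertop_real UNIV) (standard_simplex (card C - 1))"
    if "C \<subseteq> B" "C \<noteq> {}" "Inf_fin C \<noteq> 0" for C
  proof -
    have "card C \<ge> 1" using that finite_subset[OF that(1) finite_B] by (simp add: Suc_le_eq card_gt_0_iff)
    then show ?thesis using basis that unfolding is_basis_def by blast
  qed
  have "\<forall>x\<in>weights C. \<exists>h\<in>states u. \<forall>b\<in>B. h b = x b"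
    if "C \<subseteq> B" "C \<noteq> {}" "Inf_fin C \<noteq> 0" for C
    using that
  proof (induction "card C" arbitrary: C rule: less_induct)
    case less
    have finC: "finite C" using less.prems finite_B finite_subset by blast
    obtain p where p: "card C = Suc p"
      using less.prems(2) finC by (metis card_eq_0_iff old.nat.exhaust)
    obtain e where e: "bij_betw e {..p} C"
      using ex_bij_betw_nat_finite[OF finC] p by (metis atLeast0LessThan lessThan_Suc_atMost)
    note C = less.prems(1)
    have "subtopology (powertop_real UNIV) (coord e p ` face C) homeomorphic_space
        subtopology (powertop_real UNIV) (standard_simplex p)"
      using face_homeomorphic_coord[OF C e] face_of_MaxSpec_homeomorphic_states[OF u, of "B - C"]
        homeo[OF less.prems] homeomorphic_space_sym homeomorphic_space_trans p
      unfolding face_def by (metis (no_types, lifting) diff_Suc_1)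
    note homeoT = this
    have sub: "coord e p ` face C \<subseteq> standard_simplex p" using coord_in_standard_simplex[OF C e] by blast
    have "coord e p ` face C = standard_simplex p"
    proof (cases p)
      case 0
      have "coord e p ` face C \<noteq> {}"
      proof
        assume "coord e p ` face C = {}"
        then have "topspace (subtopology (powertop_real UNIV) (standard_simplex p)) = {}"
          using homeomorphic_empty_space[OF homeoT] null_topspace_iff_trivial topspace_standard_simplex
          by (metis inf_bot_right topspace_subtopology)
        then show False using nonempty_standard_simplex[of p] by (simp add: topspace_standard_simplex)
      qed
      then show ?thesis using sub unfolding 0 standard_simplex_0 by (simp add: subset_singleton_iff)
    next
      case (Suc n)
      show ?thesis
        unfolding Suc
      proof (rule contractible_supset_of_simplex_boundary)
        show "coord e (Suc n) ` face C \<subseteq> standard_simplex (Suc n)" using sub Suc by simp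
        show "contractible_space (subtopology (powertop_real UNIV) (coord e (Suc n) ` face C))"
          using homeomorphic_space_contractibility[OF homeoT] contractible_space_standard_simplex Suc by simp
      next
        fix y i assume y: "y \<in> standard_simplex (Suc n)" and i: "i \<le> Suc n" "y i = 0"
        define C' where "C' = C - {e i}"
        have eiC: "e i \<in> C" using e i(1) Suc by (auto simp: bij_betw_def)
        have C': "C' \<subseteq> B" "C' \<subseteq> C" "card C' < card C"
          unfolding C'_def using C card_Diff1_less[OF finC eiC] by blast+
        have "card C' = Suc n" using eiC finC p Suc by (simp add: C'_def)
        then have ne: "C' \<noteq> {}" by auto
        have "Inf_fin C \<le> Inf_fin C'" using C'(2) ne finC by (rule Inf_fin.subset_imp)
        moreover have "0 \<le> Inf_fin C" using finC less.prems pos C by (intro Inf_fin.boundedI) auto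
        ultimately have "Inf_fin C' \<noteq> 0" using less.prems(3) by auto
        then have real': "\<forall>x\<in>weights C'. \<exists>h\<in>states u. \<forall>b\<in>B. h b = x b"
          using less.hyps[OF C'(3,1) ne] by blast
        have "point e p C y \<in> weights C" using y Suc by (intro point_in_weights C e) simp
        moreover have "point e p C y (e i) = 0"
          using point_vertex[OF C e, of i y] i Suc mult_ge_1[of "e i"] eiC C by auto
        ultimately have "point e p C y \<in> weights C'" by (auto simp: weights_def C'_def)
        then obtain h where h: "h \<in> states u" "\<forall>b\<in>B. h b = point e p C y b" using real' by blast
        show "y \<in> coord e (Suc n) ` face C"
          using coord_eq_of_point[OF C e _ h(1)] h(2) y Suc by blast
      qed
    qed
    then show ?case using weights_realized_iff[OF C e] by blast
  qed
  then have "schauder u B m" by unfold_locales blast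
  then show ?thesis by blast
qed

lemma schauder_imp_is_basis:
  fixes u :: "'a::lattice_ab_group_add"
  assumes u: "order_unit u" and "schauder u B m"
  shows "is_basis u B"
proof -
  interpret schauder u B m by fact
  have "subtopology (spectral_topology u) {M \<in> MaxSpec u. B - C \<subseteq> M} homeomorphic_space
        subtopology (powertop_real UNIV) (standard_simplex (k - 1))"
    if C: "C \<subseteq> B" "card C = k" "Inf_fin C \<noteq> 0" and k: "k \<ge> 1" for C k
  proof -
    have finC: "finite C" "C \<noteq> {}" using C k by (auto intro: card_ge_0_finite)
    obtain p where p: "k = Suc p" using k by (cases k) auto
    obtain e where e: "bij_betw e {..p} C"
      using ex_bij_betw_nat_finite[OF finC(1)] p C(2) by (metis atLeast0LessThan lessThan_Suc_atMost)
    have "coord e p ` face C = standard_simplex p"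
      using weights_realized_iff[OF C(1) e] realizes[OF C(1) finC(2) C(3)] by blast
    then show ?thesis
      using face_homeomorphic_coord[OF C(1) e] face_of_MaxSpec_homeomorphic_states[OF u, of "B - C"]
        homeomorphic_space_sym homeomorphic_space_trans p
      unfolding face_def by (metis (no_types, lifting) diff_Suc_1)
  qed
  then show ?thesis
    unfolding is_basis_def
    using finite_B B_nonempty pos nonzero generates mult_ge_1 unit_eq by blast
qed

section \<open>Groups and semigroups spanned by a finite set\<close>

lemma grpI: "x = (\<Sum>b\<in>B. c b \<odot> b) \<Longrightarrow> x \<in> grp B"
  unfolding grp_def by blast

lemma sgrI: "x = (\<Sum>b\<in>B. c b \<odot> b) \<Longrightarrow> (\<And>b. b \<in> B \<Longrightarrow> 0 \<le> c b) \<Longrightarrow> x \<in> sgr B"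
  unfolding sgr_def by blast

lemma sgr_subset_grp: "sgr B \<subseteq> grp B"
  unfolding grp_def sgr_def by blast

lemma grp_add: "x \<in> grp B \<Longrightarrow> y \<in> grp B \<Longrightarrow> x + y \<in> grp B"
  unfolding grp_def by (auto simp flip: sum.distrib zmult_add_left)

lemma sgr_add:
  assumes "x \<in> sgr B" "y \<in> sgr B"
  shows "x + y \<in> sgr B"
proof -
  obtain c d where "x = (\<Sum>b\<in>B. c b \<odot> b)" "y = (\<Sum>b\<in>B. d b \<odot> b)" "\<forall>b\<in>B. 0 \<le> c b" "\<forall>b\<in>B. 0 \<le> d b"
    using assms unfolding sgr_def by blast
  then show ?thesis by (intro sgrI[of _ "\<lambda>b. c b + d b"]) (simp_all add: zmult_add_left sum.distrib)
qed

lemma grp_zmult: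
  assumes "x \<in> grp B"
  shows "k \<odot> x \<in> grp B"
proof -
  obtain c where "x = (\<Sum>b\<in>B. c b \<odot> b)" using assms unfolding grp_def by blast
  then show ?thesis by (intro grpI[of _ "\<lambda>b. k * c b"]) (simp add: zmult_sum_right zmult_zmult)
qed

lemma sgr_zmult:
  assumes "x \<in> sgr B" "0 \<le> k"
  shows "k \<odot> x \<in> sgr B"
proof -
  obtain c where "x = (\<Sum>b\<in>B. c b \<odot> b)" "\<forall>b\<in>B. 0 \<le> c b" using assms unfolding sgr_def by blast
  then show ?thesis
    using assms(2) by (intro sgrI[of _ "\<lambda>b. k * c b"]) (simp_all add: zmult_sum_right zmult_zmult)
qed

lemma grp_minus: "x \<in> grp B \<Longrightarrow> - x \<in> grp B"
  using grp_zmult[of x B "-1"] by (simp add: zmult_minus_left)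

lemma grp_diff: "x \<in> grp B \<Longrightarrow> y \<in> grp B \<Longrightarrow> x - y \<in> grp B"
  using grp_add[OF _ grp_minus] by (metis diff_conv_add_uminus)

lemma zero_in_sgr: "0 \<in> sgr B"
  by (rule sgrI[of _ "\<lambda>_. 0"]) simp_all

lemma zero_in_grp: "0 \<in> grp B"
  using zero_in_sgr sgr_subset_grp by blast

lemma sgr_sum: "(\<And>i. i \<in> I \<Longrightarrow> f i \<in> sgr B) \<Longrightarrow> (\<Sum>i\<in>I. f i) \<in> sgr B"
  by (induction I rule: infinite_finite_induct) (auto simp: zero_in_sgr sgr_add)

lemma grp_sum: "(\<And>i. i \<in> I \<Longrightarrow> f i \<in> grp B) \<Longrightarrow> (\<Sum>i\<in>I. f i) \<in> grp B"
  by (induction I rule: infinite_finite_induct) (auto simp: zero_in_grp grp_add)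

lemma in_sgr:
  assumes "finite B" "b \<in> B"
  shows "b \<in> sgr B"
proof (rule sgrI)
  have "(\<Sum>x\<in>B. (if x = b then 1 else 0) \<odot> x) = (\<Sum>x\<in>B. if x = b then x else 0)"
    by (rule sum.cong) auto
  then show "b = (\<Sum>x\<in>B. (if x = b then 1 else 0) \<odot> x)" using assms by simp
qed simp

lemma sgr_mono: "B \<subseteq> sgr B' \<Longrightarrow> sgr B \<subseteq> sgr B'"
  unfolding sgr_def[of B] by (auto intro!: sgr_sum sgr_zmult)

lemma grp_mono: "B \<subseteq> sgr B' \<Longrightarrow> grp B \<subseteq> grp B'"
  using sgr_subset_grp[of B'] unfolding grp_def[of B] by (auto intro!: grp_sum grp_zmult)

lemma l_generated_mono: "B \<subseteq> l_generated B' \<Longrightarrow> l_generated B \<subseteq> l_generated B'"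
proof
  fix x assume sub: "B \<subseteq> l_generated B'" and "x \<in> l_generated B"
  from this(2) show "x \<in> l_generated B'"
    by induction (use sub in \<open>auto intro: l_generated.intros\<close>)
qed

section \<open>Subdivision\<close>

context schauder
begin

text \<open>The state at the vertex of \<open>b\<close>, where all other basis elements vanish.\<close>
lemma vertex_state:
  assumes b: "b \<in> B"
  shows "\<exists>h\<in>states u. 0 < h b \<and> (\<forall>z\<in>B. z \<noteq> b \<longrightarrow> h z = 0)"
proof -
  define x where "x z = (if z = b then 1 / of_int (m b) else 0 :: real)" for z
  have mb: "0 < m b" using mult_ge_1[OF b] by simp
  have "(\<Sum>z\<in>B. of_int (m z) * x z) = (\<Sum>z\<in>B. if z = b then 1 else 0)"
    using mb by (intro sum.cong) (auto simp: x_def)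
  then have "x \<in> weights {b}" using mb b finite_B by (simp add: weights_def x_def)
  then obtain h where "h \<in> states u" "\<forall>b\<in>B. h b = x b"
    using realizes[of "{b}" x] b nonzero[OF b] by auto
  then show ?thesis using b mb by (intro bexI[of _ h]) (auto simp: x_def)
qed

text \<open>A state in the interior of an edge; equal values make \<open>inf a b\<close> positive there.\<close>
lemma edge_state:
  assumes a: "a \<in> B" and b: "b \<in> B" and ab: "a \<noteq> b" "inf a b \<noteq> 0"
  shows "\<exists>h\<in>states u. 0 < h a \<and> h b = h a \<and> (\<forall>z\<in>B. z \<noteq> a \<and> z \<noteq> b \<longrightarrow> h z = 0)"
proof -
  define t :: real where "t = 1 / (of_int (m a) + of_int (m b))"
  define x where "x z = (if z = a \<or> z = b then t else 0)" for z
  have mab: "0 < real_of_int (m a) + of_int (m b)" using mult_ge_1[OF a] mult_ge_1[OF b] by simp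
  have "(\<Sum>z\<in>B. of_int (m z) * x z) = (\<Sum>z\<in>{a, b}. of_int (m z) * x z)"
    using a b finite_B by (intro sum.mono_neutral_right) (auto simp: x_def)
  also have "\<dots> = (of_int (m a) + of_int (m b)) * t" using ab by (simp add: x_def algebra_simps)
  also have "\<dots> = 1" using mab by (simp add: t_def)
  finally have "x \<in> weights {a, b}" using mab by (simp add: weights_def x_def t_def)
  then obtain h where "h \<in> states u" "\<forall>b\<in>B. h b = x b"
    using realizes[of "{a, b}" x] a b ab by (auto simp: Inf_fin.insert_not_elem)
  then show ?thesis using a b mab by (intro bexI[of _ h]) (auto simp: x_def t_def)
qed

lemma independent:
  assumes "(\<Sum>b\<in>B. c b \<odot> b) = (\<Sum>b\<in>B. d b \<odot> b)" "b \<in> B"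
  shows "c b = d b"
proof -
  obtain h where h: "h \<in> states u" "0 < h b" "\<forall>z\<in>B. z \<noteq> b \<longrightarrow> h z = 0"
    using vertex_state[OF assms(2)] by blast
  have eval: "h (\<Sum>b\<in>B. k b \<odot> b) = of_int (k b) * h b" for k
  proof -
    have "h (\<Sum>b\<in>B. k b \<odot> b) = (\<Sum>z\<in>B. if z = b then of_int (k b) * h b else 0)"
      unfolding state_sum[OF h(1)] state_zmult[OF h(1)] using h(3) by (intro sum.cong) auto
    then show ?thesis using finite_B assms(2) by simp
  qed
  show ?thesis using arg_cong[OF assms(1), of h] h(2) by (simp add: eval)
qed

end

text \<open>
  The subdivision of an edge. The name \<open>c\<close> for \<open>inf a b\<close> keeps differences such as \<open>a - inf a b\<close> from
  being rewritten.
\<close>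
locale edge = schauder +
  fixes a b c :: 'a
  assumes a_in: "a \<in> B" and b_in: "b \<in> B" and a_neq_b: "a \<noteq> b"
    and c_eq: "c = inf a b" and c_nonzero: "c \<noteq> 0"
begin

definition B' :: "'a set" where
  "B' = insert (a - c) (insert (b - c) (insert (c) (B - {a, b})))"

text \<open>
  The coefficients after the subdivision of a combination with coefficients \<open>k\<close>, as
  \<open>a = (a - c) + c\<close> and \<open>b = (b - c) + c\<close>. Multiplicities are transferred in the same way.
\<close>
definition transfer :: "('a \<Rightarrow> int) \<Rightarrow> 'a \<Rightarrow> int" where
  "transfer k = k(a - c := k a, b - c := k b, c := k a + k b)"

text \<open>
  The elements are told apart by their values at the vertices \<open>a\<close> and \<open>b\<close> and at a point of the edge
  between them.
\<close>
lemma new_elements: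
  "a - c \<noteq> b - c" "a - c \<noteq> c" "b - c \<noteq> c"
  "a - c \<notin> B - {a, b}" "b - c \<notin> B - {a, b}" "c \<notin> B - {a, b}"
  "a - c \<noteq> 0" "b - c \<noteq> 0"
proof -
  obtain f where f: "f \<in> states u" "0 < f a" "\<forall>z\<in>B. z \<noteq> a \<longrightarrow> f z = 0"
    using vertex_state[OF a_in] by blast
  obtain g where g: "g \<in> states u" "0 < g b" "\<forall>z\<in>B. z \<noteq> b \<longrightarrow> g z = 0"
    using vertex_state[OF b_in] by blast
  obtain h where h: "h \<in> states u" "0 < h a" "h b = h a" "\<forall>z\<in>B. z \<noteq> a \<and> z \<noteq> b \<longrightarrow> h z = 0"
    using edge_state[OF a_in b_in a_neq_b] c_nonzero c_eq by blast
  have "f c = min (f a) (f b)" "g c = min (g a) (g b)" "h c = min (h a) (h b)"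
    by (simp_all only: c_eq state_inf[OF f(1)] state_inf[OF g(1)] state_inf[OF h(1)])
  moreover have "f b = 0" "g a = 0" using f(3) g(3) a_in b_in a_neq_b by simp_all
  ultimately have F: "f c = 0" "f (a - c) > 0" and G: "g c = 0" "g (b - c) > 0" and Hc: "h c > 0"
    using f(2) g(2) h(2,3) by (simp_all add: state_diff[OF f(1)] state_diff[OF g(1)])
  show "a - c \<noteq> b - c" using a_neq_b by simp
  show "a - c \<noteq> c" by (metis F(1,2) less_irrefl)
  show "b - c \<noteq> c" by (metis G(1,2) less_irrefl)
  show "a - c \<notin> B - {a, b}" using F(2) f(3) by (metis DiffD1 DiffD2 insertI1 less_irrefl)
  show "b - c \<notin> B - {a, b}" using G(2) g(3) by (metis DiffD1 DiffD2 insertI1 insertI2 less_irrefl)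
  show "c \<notin> B - {a, b}" using Hc h(4) by (metis DiffD1 DiffD2 insertI1 insertI2 less_irrefl)
  show "a - c \<noteq> 0" by (metis F(2) state_zero[OF f(1)] less_irrefl)
  show "b - c \<noteq> 0" by (metis G(2) state_zero[OF g(1)] less_irrefl)
qed

lemma sum_B: "(\<Sum>z\<in>B. f z) = f a + f b + (\<Sum>z\<in>B - {a, b}. f z)"
  for f :: "'a \<Rightarrow> 'c::comm_monoid_add"
proof -
  have "(\<Sum>z\<in>B. f z) = (\<Sum>z\<in>insert a (insert b (B - {a, b})). f z)"
    using a_in b_in by (intro sum.cong) auto
  then show ?thesis using finite_B a_neq_b by (simp add: add.assoc)
qed

lemma sum_B': "(\<Sum>z\<in>B'. f z) = f (a - c) + f (b - c) + f (c) + (\<Sum>z\<in>B - {a, b}. f z)"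
  for f :: "'a \<Rightarrow> 'c::comm_monoid_add"
  unfolding B'_def using finite_B new_elements by (simp add: add.assoc)

lemma transfer_simps:
  "transfer k (a - c) = k a" "transfer k (b - c) = k b" "transfer k (c) = k a + k b"
  "z \<in> B - {a, b} \<Longrightarrow> transfer k z = k z"
  using new_elements by (auto simp: transfer_def)

lemma transfer_sum: "(\<Sum>z\<in>B'. transfer k z \<odot> z) = (\<Sum>z\<in>B. k z \<odot> z)"
proof -
  have "(\<Sum>z\<in>B - {a, b}. transfer k z \<odot> z) = (\<Sum>z\<in>B - {a, b}. k z \<odot> z)"
    by (intro sum.cong) (simp_all only: transfer_simps)
  then show ?thesis
    by (simp add: sum_B sum_B' transfer_simps zmult_add_left zmult_diff_right)
qed

lemma nonneg_parts: "0 \<le> a - c" "0 \<le> b - c" "0 \<le> c"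
  using pos[OF a_in] pos[OF b_in] by (simp_all add: c_eq del: diff_inf_eq_sup)

lemma parts_le: "a - c \<le> a" "b - c \<le> b" "c \<le> a" "c \<le> b"
  using nonneg_parts by simp_all

lemma parts_disjoint: "inf (a - c) (b - c) = 0"
  using add_inf_distrib_right[of a b "- c", folded c_eq] by simp

lemma B_subset_sgr_B': "B \<subseteq> sgr B'"
proof
  fix z assume "z \<in> B"
  have fin: "finite B'" by (simp add: B'_def finite_B)
  consider "z = (a - c) + c" | "z = (b - c) + c" | "z \<in> B - {a, b}"
    using \<open>z \<in> B\<close> by auto
  then show "z \<in> sgr B'"
  proof cases
    case 1 show ?thesis unfolding 1 by (intro sgr_add in_sgr fin) (simp_all add: B'_def)
  next
    case 2 show ?thesis unfolding 2 by (intro sgr_add in_sgr fin) (simp_all add: B'_def)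
  next
    case 3 show ?thesis by (intro in_sgr fin) (use 3 in \<open>simp add: B'_def\<close>)
  qed
qed

text \<open>
  Since \<open>a - c\<close> and \<open>b - c\<close> are disjoint, a face of the subdivision contains at most one of them.
  Prescribed values \<open>x\<close> on such a face force the values \<open>x (a - c) + x c\<close> and \<open>x (b - c) + x c\<close> at
  \<open>a\<close> and \<open>b\<close>. These lie on a face of the old triangulation, so a state realizes them; and it has the
  value \<open>x c\<close> at \<open>c\<close> because one of \<open>x (a - c)\<close> and \<open>x (b - c)\<close> is zero.
\<close>
lemma schauder_B': "schauder u B' (transfer m)"
proof -
  interpret new: positive_generators u B' "transfer m"
  proof
    show "finite B'" "B' \<noteq> {}" by (simp_all add: B'_def finite_B)
    fix z assume "z \<in> B'"
    then consider "z = a - c" | "z = b - c" | "z = c" | "z \<in> B - {a, b}" by (auto simp: B'_def)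
    then have "0 \<le> z \<and> z \<noteq> 0 \<and> 1 \<le> transfer m z"
    proof cases
      case 4 then show ?thesis using pos nonzero mult_ge_1 transfer_simps(4)[of z m] by auto
    qed (use nonneg_parts new_elements c_nonzero mult_ge_1[OF a_in] mult_ge_1[OF b_in] in
        \<open>simp_all add: transfer_simps(1-3)\<close>)
    then show "0 \<le> z" "z \<noteq> 0" "1 \<le> transfer m z" by blast+
  next
    have "z \<in> l_generated B'" if z: "z \<in> B" for z
    proof -
      consider "z = (a - c) + c" | "z = (b - c) + c" | "z \<in> B'" using z by (auto simp: B'_def)
      then show ?thesis
      proof cases
        case 1 show ?thesis unfolding 1 by (intro l_generated.add l_generated.gen) (simp_all add: B'_def)
      next
        case 2 show ?thesis unfolding 2 by (intro l_generated.add l_generated.gen) (simp_all add: B'_def)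
      qed (rule l_generated.gen)
    qed
    then show "l_generated B' = UNIV" using l_generated_mono[of B B'] generates by blast
    show "(\<Sum>z\<in>B'. transfer m z \<odot> z) = u" by (simp only: transfer_sum unit_eq)
  qed
  show ?thesis
  proof
    fix C' x assume C': "C' \<subseteq> B'" "C' \<noteq> {}" "Inf_fin C' \<noteq> 0" and x: "x \<in> new.weights C'"
    have finC': "finite C'" using C'(1) new.finite_B finite_subset by blast
    have lower: "Inf_fin C' \<le> z" if "z \<in> C'" for z using finC' that by (rule Inf_fin.coboundedI)
    have Inf_nonneg: "0 \<le> Inf_fin C'" using finC' C' new.pos by (intro Inf_fin.boundedI) auto
    have x_nonneg: "0 \<le> x z" and x_out: "z \<notin> C' \<Longrightarrow> x z = 0" for z using x by (auto simp: new.weights_def)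
    have "\<not> (a - c \<in> C' \<and> b - c \<in> C')"
      using lower Inf_nonneg C'(3) parts_disjoint by (metis antisym le_inf_iff)
    then have disj: "x (a - c) = 0 \<or> x (b - c) = 0" using x_out by blast
    define y where "y z = (if z = a then x (a - c) + x c else if z = b then x (b - c) + x c
      else if z \<in> B then x z else 0)" for z
    define C where "C = {z \<in> B. y z \<noteq> 0}"
    have y_sum: "(\<Sum>z\<in>B. of_int (m z) * y z) = 1"
    proof -
      have "(\<Sum>z\<in>B - {a, b}. of_int (m z) * y z) = (\<Sum>z\<in>B - {a, b}. of_int (transfer m z) * x z)"
        by (intro sum.cong refl) (simp add: y_def transfer_simps(4) del: Diff_insert)
      then have "(\<Sum>z\<in>B. of_int (m z) * y z) = (\<Sum>z\<in>B'. of_int (transfer m z) * x z)"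
        using a_neq_b by (simp add: sum_B sum_B' transfer_simps(1-3) y_def algebra_simps)
      then show ?thesis using x by (simp add: new.weights_def)
    qed
    then have "y \<in> weights C" using a_in b_in x_nonneg by (auto simp: weights_def C_def y_def)
    moreover have C_ne: "C \<noteq> {}"
    proof
      assume "C = {}"
      then have "(\<Sum>z\<in>B. of_int (m z) * y z) = 0" by (intro sum.neutral) (auto simp: C_def)
      then show False using y_sum by simp
    qed
    moreover have "Inf_fin C \<noteq> 0"
    proof -
      have "Inf_fin C' \<le> z" if z: "z \<in> C" for z
      proof -
        consider "z = a" "a - c \<in> C' \<or> c \<in> C'" | "z = b" "b - c \<in> C' \<or> c \<in> C'" | "z \<in> C'"
          using z x_out unfolding C_def y_def by (auto split: if_splits) (metis add.left_neutral)+
        then show ?thesis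
          by cases (use lower parts_le in \<open>blast intro: order_trans\<close>)+
      qed
      then have "Inf_fin C' \<le> Inf_fin C" using C_ne finite_B by (intro Inf_fin.boundedI) (auto simp: C_def)
      then show ?thesis using Inf_nonneg C'(3) by auto
    qed
    ultimately obtain h where h: "h \<in> states u" "\<forall>z\<in>B. h z = y z"
      using realizes[of C y] by (auto simp: C_def)
    have ha: "h a = x (a - c) + x c" and hb: "h b = x (b - c) + x c"
      using h(2) a_in b_in a_neq_b by (simp_all add: y_def)
    have hc: "h c = x c"
    proof -
      have "h c = min (h a) (h b)" by (simp only: c_eq state_inf[OF h(1)])
      then show ?thesis using disj x_nonneg[of "a - c"] x_nonneg[of "b - c"] by (auto simp: ha hb)
    qed
    have "h z = x z" if "z \<in> B'" for z
      using that h(2) unfolding B'_def by (auto simp: state_diff[OF h(1)] ha hb hc y_def)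
    then show "\<exists>h\<in>states u. \<forall>b\<in>B'. h b = x b" using h(1) by blast
  qed
qed

end

section \<open>Refinements\<close>

text \<open>Edges along which the piecewise linear function with vertex coefficients \<open>k\<close> changes sign.\<close>
definition conflicts :: "'a::lattice_ab_group_add set \<Rightarrow> ('a \<Rightarrow> int) \<Rightarrow> ('a \<times> 'a) set" where
  "conflicts B k = {(x, y). x \<in> B \<and> y \<in> B \<and> 0 < k x \<and> k y < 0 \<and> inf x y \<noteq> 0}"

abbreviation gap :: "('a \<Rightarrow> int) \<Rightarrow> 'a \<times> 'a \<Rightarrow> int" where
  "gap k e \<equiv> k (fst e) - k (snd e)"

lemma inf_nonzero_mono:
  fixes x y :: "'a::lattice_ab_group_add"
  assumes "inf x y \<noteq> 0" "0 \<le> x" "0 \<le> y" "x \<le> x'" "y \<le> y'"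
  shows "inf x' y' \<noteq> 0"
  using assms by (metis antisym inf_greatest inf_mono)

text \<open>
  The coefficient \<open>k a + k b\<close> of the new vertex \<open>c\<close> is strictly between \<open>k b\<close> and \<open>k a\<close>. If \<open>y\<close> is an
  old vertex, a conflict \<open>(c, y)\<close> has a smaller gap than \<open>(a, y)\<close>, which is a conflict too as \<open>c \<le> a\<close>,
  and a conflict of \<open>c\<close> with \<open>b - c\<close> has gap \<open>k a\<close>; similarly for \<open>(x, c)\<close>. All other conflicts come from old ones by replacing \<open>a\<close> by \<open>a - c\<close> and \<open>b\<close> by
  \<open>b - c\<close>; the conflict \<open>(a, b)\<close> itself disappears because \<open>a - c\<close> and \<open>b - c\<close> are disjoint. So the
  subdivision of a conflict of largest gap creates no larger gap and leaves fewer conflicts with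
  this gap.
\<close>
lemma (in edge) conflicts_transfer:
  assumes ka: "0 < k a" and kb: "k b < 0"
    and max: "\<And>e. e \<in> conflicts B k \<Longrightarrow> gap k e \<le> k a - k b"
  defines "S \<equiv> {e \<in> conflicts B k. gap k e = k a - k b}"
    and "S' \<equiv> {e \<in> conflicts B' (transfer k). gap (transfer k) e = k a - k b}"
  shows "\<forall>e\<in>conflicts B' (transfer k). gap (transfer k) e \<le> k a - k b"
    and "card S' < card S"
proof -
  have pos': "0 \<le> z" if "z \<in> B'" for z
    using that nonneg_parts pos by (auto simp: B'_def)
  (* the vertex of B from which a new vertex other than c originates *)
  define \<psi> where "\<psi> z = (if z = a - c then a else if z = b - c then b else z)" for z
  have cases: "z = a - c \<or> z = b - c \<or> z = c \<or> z \<in> B - {a, b}" if "z \<in> B'" for z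
    using that by (auto simp: B'_def)
  have \<psi>_simps: "\<psi> (a - c) = a" "\<psi> (b - c) = b" "z \<in> B - {a, b} \<Longrightarrow> \<psi> z = z" for z
    using new_elements by (auto simp: \<psi>_def)
  have \<psi>_B: "\<psi> z \<in> B \<and> z \<le> \<psi> z \<and> transfer k z = k (\<psi> z)" if "z \<in> B'" "z \<noteq> c" for z
    using cases[OF that(1)] that(2) a_in b_in parts_le by (auto simp: \<psi>_simps transfer_simps)
  have main: "(gap (transfer k) (x, y) < k a - k b) \<or>
      (x \<noteq> c \<and> y \<noteq> c \<and> (\<psi> x, \<psi> y) \<in> conflicts B k \<and> gap (transfer k) (x, y) = gap k (\<psi> x, \<psi> y))"
    if "(x, y) \<in> conflicts B' (transfer k)" for x y
  proof -
    have xy: "x \<in> B'" "y \<in> B'" "0 < transfer k x" "transfer k y < 0" "inf x y \<noteq> 0"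
      using that by (auto simp: conflicts_def)
    note mono = inf_nonzero_mono[OF xy(5) pos'[OF xy(1)] pos'[OF xy(2)]]
    consider "x = c" | "y = c" "x \<noteq> c" | "x \<noteq> c" "y \<noteq> c" by blast
    then show ?thesis
    proof cases
      case 1
      then have kx: "transfer k x = k a + k b" "y \<noteq> c" using xy(3,4) by (auto simp: transfer_simps)
      from cases[OF xy(2)] kx(2) consider "y = a - c" | "y = b - c" | "y \<in> B - {a, b}" by blast
      then show ?thesis
      proof cases
        case 1 then show ?thesis using xy(4) ka by (simp add: transfer_simps)
      next
        case 2 then show ?thesis using kx(1) kb by (simp add: transfer_simps)
      next
        case 3
        then have "(a, y) \<in> conflicts B k"
          using xy(4) mono[of a y] \<open>x = c\<close> parts_le a_in ka by (auto simp: conflicts_def transfer_simps)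
        then have "k a - k y \<le> k a - k b" using max by fastforce
        then show ?thesis using kx(1) kb 3 by (simp add: transfer_simps(4) del: Diff_insert)
      qed
    next
      case 2
      then have ky: "transfer k y = k a + k b" by (simp add: transfer_simps)
      from cases[OF xy(1)] 2(2) consider "x = a - c" | "x = b - c" | "x \<in> B - {a, b}" by blast
      then show ?thesis
      proof cases
        case 1 then show ?thesis using ky ka by (simp add: transfer_simps)
      next
        case 2 then show ?thesis using xy(3) kb by (simp add: transfer_simps)
      next
        case 3
        then have "(x, b) \<in> conflicts B k"
          using xy(3) mono[of x b] \<open>y = c\<close> parts_le b_in kb by (auto simp: conflicts_def transfer_simps)
        then have "k x - k b \<le> k a - k b" using max by fastforce
        then show ?thesis using ky ka 3 by (simp add: transfer_simps(4) del: Diff_insert)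
      qed
    next
      case 3
      have "inf (\<psi> x) (\<psi> y) \<noteq> 0" using mono \<psi>_B[OF xy(1) 3(1)] \<psi>_B[OF xy(2) 3(2)] by blast
      then show ?thesis
        using 3 \<psi>_B[OF xy(1) 3(1)] \<psi>_B[OF xy(2) 3(2)] xy(3,4) by (auto simp: conflicts_def)
    qed
  qed
  show "\<forall>e\<in>conflicts B' (transfer k). gap (transfer k) e \<le> k a - k b"
  proof
    fix e assume "e \<in> conflicts B' (transfer k)"
    then show "gap (transfer k) e \<le> k a - k b"
      using main[of "fst e" "snd e"] max[of "(\<psi> (fst e), \<psi> (snd e))"] by fastforce
  qed
  have \<psi>_cases: "z = a - c \<and> \<psi> z = a \<or> z = b - c \<and> \<psi> z = b \<or> \<psi> z = z \<and> z \<noteq> a \<and> z \<noteq> b"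
    if "z \<in> B'" "z \<noteq> c" for z
    using cases[OF that(1)] that(2) \<psi>_simps(1,2) \<psi>_simps(3)[of z] by (metis DiffD2 insertI1 insertI2)
  have inj_\<psi>: "z = z'" if z: "z \<in> B'" "z' \<in> B'" "z \<noteq> c" "z' \<noteq> c" and eq: "\<psi> z = \<psi> z'" for z z'
  proof -
    show ?thesis using \<psi>_cases[OF z(1,3)] \<psi>_cases[OF z(2,4)] eq a_neq_b by metis
  qed
  have in_S: "x \<noteq> c \<and> y \<noteq> c \<and> x \<in> B' \<and> y \<in> B' \<and> (\<psi> x, \<psi> y) \<in> S - {(a, b)}" if "(x, y) \<in> S'" for x y
  proof -
    have xy: "(x, y) \<in> conflicts B' (transfer k)" "gap (transfer k) (x, y) = k a - k b"
      using that by (auto simp: S'_def)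
    then have *: "x \<noteq> c" "y \<noteq> c" "(\<psi> x, \<psi> y) \<in> S" using main[OF xy(1)] by (auto simp: S_def)
    have B': "x \<in> B'" "y \<in> B'" "inf x y \<noteq> 0" using xy(1) by (auto simp: conflicts_def)
    have "(\<psi> x, \<psi> y) \<noteq> (a, b)"
    proof
      assume eq: "(\<psi> x, \<psi> y) = (a, b)"
      then have "\<psi> x = \<psi> (a - c)" "\<psi> y = \<psi> (b - c)" by (simp_all add: \<psi>_simps)
      moreover have "a - c \<in> B'" "b - c \<in> B'" by (simp_all add: B'_def)
      ultimately have "x = a - c" "y = b - c"
        using inj_\<psi>[OF B'(1) _ *(1) new_elements(2)] inj_\<psi>[OF B'(2) _ *(2) new_elements(3)] by blast+
      then show False using B'(3) parts_disjoint by simp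
    qed
    then show ?thesis using * B' by simp
  qed
  have "inj_on (map_prod \<psi> \<psi>) S'"
    using in_S inj_\<psi> by (auto simp: inj_on_def)
  moreover have "map_prod \<psi> \<psi> ` S' \<subseteq> S - {(a, b)}" using in_S by auto
  moreover have finS: "finite S"
    by (rule finite_subset[of _ "B \<times> B"]) (auto simp: S_def conflicts_def finite_B)
  ultimately have "card S' \<le> card (S - {(a, b)})" by (simp add: card_inj_on_le)
  also have "\<dots> < card S"
  proof (rule card_Diff1_less[OF finS])
    show "(a, b) \<in> S" using a_in b_in ka kb c_nonzero c_eq by (auto simp: S_def conflicts_def)
  qed
  finally show "card S' < card S" .
qed

lemma schauder_subset_sgr:
  assumes "schauder u B m"
  shows "B \<subseteq> sgr B"
proof -
  interpret schauder u B m by fact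
  show ?thesis using in_sgr[OF finite_B] by blast
qed

text \<open>
  Lexicographic induction on a bound for the gaps and the number of conflicts that attain it.
\<close>
lemma schauder_resolve_conflicts:
  fixes u :: "'a::lattice_ab_group_add"
  assumes "schauder u B m" and "\<forall>e\<in>conflicts B k. gap k e \<le> int s"
  shows "\<exists>B' m' k'. schauder u B' m' \<and> B \<subseteq> sgr B' \<and> conflicts B' k' = {} \<and>
    (\<Sum>b\<in>B'. k' b \<odot> b) = (\<Sum>b\<in>B. k b \<odot> b)"
  using assms
proof (induction s arbitrary: B m k)
  case 0
  have "conflicts B k = {}" using 0(2) by (force simp: conflicts_def)
  moreover have "B \<subseteq> sgr B"
    by (rule schauder_subset_sgr[OF 0(1)])
  ultimately show ?case using 0(1) by blast
next
  case (Suc s)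
  show ?case
    using Suc.prems
  proof (induction "card {e \<in> conflicts B k. gap k e = int (Suc s)}" arbitrary: B m k rule: less_induct)
    case (less B k m)
    interpret schauder u B m by fact
    let ?S = "{e \<in> conflicts B k. gap k e = int (Suc s)}"
    show ?case
    proof (cases "?S = {}")
      case True
      then have "\<forall>e\<in>conflicts B k. gap k e \<le> int s" using less.prems(2) by fastforce
      then show ?thesis by (rule Suc.IH[OF less.prems(1)])
    next
      case False
      then obtain a b where ab: "(a, b) \<in> conflicts B k" "k a - k b = int (Suc s)" by auto
      then have kab: "0 < k a" "k b < 0" by (auto simp: conflicts_def)
      interpret edge u B m a b "inf a b"
        using ab kab by unfold_locales (auto simp: conflicts_def)
      have max: "gap k e \<le> k a - k b" if "e \<in> conflicts B k" for e using less.prems(2) that ab(2) by simp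
      have "\<forall>e\<in>conflicts B' (transfer k). gap (transfer k) e \<le> int (Suc s)"
        using conflicts_transfer(1)[OF kab max] ab(2) by simp
      moreover have "card {e \<in> conflicts B' (transfer k). gap (transfer k) e = int (Suc s)} < card ?S"
        using conflicts_transfer(2)[OF kab max] ab(2) by simp
      ultimately obtain B'' m'' k'' where *: "schauder u B'' m''" "B' \<subseteq> sgr B''" "conflicts B'' k'' = {}"
        "(\<Sum>b\<in>B''. k'' b \<odot> b) = (\<Sum>b\<in>B'. transfer k b \<odot> b)"
        using less.hyps[OF _ schauder_B'] by blast
      have "B \<subseteq> sgr B''" using B_subset_sgr_B' sgr_mono[OF *(2)] by blast
      then show ?thesis using * transfer_sum by metis
    qed
  qed
qed

text \<open>
  Without conflicts each term with positive coefficient is disjoint from each term with negative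
  coefficient, so the two partial sums are the positive and the negative part.
\<close>
lemma pprt_in_sgr_of_no_conflicts:
  fixes B :: "'a::lattice_ab_group_add set"
  assumes fin: "finite B" and pos: "\<And>b. b \<in> B \<Longrightarrow> 0 \<le> b" and no: "conflicts B k = {}"
  shows "pprt (\<Sum>b\<in>B. k b \<odot> b) \<in> sgr B"
proof -
  define P where "P = (\<Sum>b\<in>{b \<in> B. 0 < k b}. k b \<odot> b)"
  define N where "N = (\<Sum>b\<in>{b \<in> B. k b < 0}. (- k b) \<odot> b)"
  have "(\<Sum>b\<in>B. k b \<odot> b) = (\<Sum>b\<in>B. (if 0 < k b then k b \<odot> b else 0) - (if k b < 0 then (- k b) \<odot> b else 0))"
    by (rule sum.cong) (auto simp: zmult_minus_left)
  also have "\<dots> = P - N"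
    unfolding sum_subtractf P_def N_def using fin by (simp add: sum.inter_filter)
  finally have eq: "(\<Sum>b\<in>B. k b \<odot> b) = P - N" .
  have disj: "inf (k x \<odot> x) ((- k y) \<odot> y) = 0" if "x \<in> B" "0 < k x" "y \<in> B" "k y < 0" for x y
  proof -
    have "inf x y = 0" using no that by (auto simp: conflicts_def)
    then have "inf x ((- k y) \<odot> y) = 0" using that pos by (intro inf_zmult_eq_zero) auto
    then have "inf ((- k y) \<odot> y) (k x \<odot> x) = 0"
      using that pos by (intro inf_zmult_eq_zero) (auto simp: inf_commute intro: zmult_nonneg)
    then show ?thesis by (simp add: inf_commute)
  qed
  have "inf P ((- k y) \<odot> y) = 0" if "y \<in> B" "k y < 0" for y
    unfolding P_def inf_commute[of _ "(- k y) \<odot> y"]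
  proof (rule inf_sum_eq_zero)
    show "0 \<le> (- k y) \<odot> y" using that pos by (intro zmult_nonneg) auto
    fix x assume "x \<in> {b \<in> B. 0 < k b}"
    then show "0 \<le> k x \<odot> x" "inf ((- k y) \<odot> y) (k x \<odot> x) = 0"
      using disj[of x y] that pos by (auto simp: inf_commute intro: zmult_nonneg)
  qed
  then have "inf P N = 0"
    unfolding N_def using pos by (intro inf_sum_eq_zero) (auto simp: P_def intro!: sum_nonneg zmult_nonneg)
  then have "pprt (P - N) = P" by (rule pprt_diff_of_disjoint)
  moreover have "P \<in> sgr B"
    unfolding P_def using fin by (intro sgr_sum sgr_zmult in_sgr) auto
  ultimately show ?thesis by (simp add: eq)
qed

lemma schauder_refine_pprt:
  fixes u :: "'a::lattice_ab_group_add"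
  assumes B: "schauder u B m" and g: "g \<in> grp B"
  shows "\<exists>B' m'. schauder u B' m' \<and> B \<subseteq> sgr B' \<and> pprt g \<in> sgr B'"
proof -
  interpret schauder u B m by fact
  obtain k where k: "g = (\<Sum>b\<in>B. k b \<odot> b)" using g unfolding grp_def by blast
  have fin: "finite (conflicts B k)"
    by (rule finite_subset[of _ "B \<times> B"]) (auto simp: conflicts_def finite_B)
  define s where "s = (\<Sum>e\<in>conflicts B k. nat (gap k e))"
  have "gap k e \<le> int s" if "e \<in> conflicts B k" for e
  proof -
    have "nat (gap k e) \<le> s" unfolding s_def using that fin by (intro member_le_sum) auto
    then show ?thesis by linarith
  qed
  then obtain B' m' k' where B': "schauder u B' m'" "B \<subseteq> sgr B'" "conflicts B' k' = {}"
    "(\<Sum>b\<in>B'. k' b \<odot> b) = g"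
    using schauder_resolve_conflicts[OF B] k by metis
  interpret B': schauder u B' m' by fact
  have "pprt g \<in> sgr B'"
    using pprt_in_sgr_of_no_conflicts[OF B'.finite_B B'.pos B'(3)] B'(4) by simp
  then show ?thesis using B' by blast
qed

text \<open>
  Induction on the generation of \<open>x\<close> from \<open>B0\<close>. As the arguments of an operation are reached one after
  the other, the induction hypothesis has to start from an arbitrary refinement of \<open>B0\<close>. Suprema and
  infima are expressed by the positive part of a difference.
\<close>
lemma schauder_refine_grp:
  fixes u :: "'a::lattice_ab_group_add"
  assumes B0: "schauder u B0 m0" and "schauder u B m" "B0 \<subseteq> grp B"
  shows "\<exists>B' m'. schauder u B' m' \<and> B \<subseteq> sgr B' \<and> x \<in> grp B'"
proof -
  interpret B0: schauder u B0 m0 by fact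
  define reach where "reach X \<longleftrightarrow> (\<forall>B m. schauder u B m \<longrightarrow> B0 \<subseteq> grp B \<longrightarrow>
    (\<exists>B' m'. schauder u B' m' \<and> B \<subseteq> sgr B' \<and> X \<subseteq> grp B'))" for X
  have reachD: "\<exists>B' m'. schauder u B' m' \<and> B \<subseteq> sgr B' \<and> X \<subseteq> grp B'"
    if "reach X" "schauder u B m" "B0 \<subseteq> grp B" for X B m
    using that unfolding reach_def by blast
  have reach_mono: "reach Y" if "reach X" "\<And>B. X \<subseteq> grp B \<Longrightarrow> Y \<subseteq> grp B" for X Y
    using that unfolding reach_def by meson
  have reach_Un: "reach (X \<union> Y)" if X: "reach X" and Y: "reach Y" for X Y
    unfolding reach_def
  proof (intro allI impI)
    fix B m assume B: "schauder u B m" "B0 \<subseteq> grp B"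
    obtain B1 m1 where 1: "schauder u B1 m1" "B \<subseteq> sgr B1" "X \<subseteq> grp B1" using reachD[OF X B] by blast
    have "B0 \<subseteq> grp B1" using B(2) grp_mono[OF 1(2)] by blast
    then obtain B2 m2 where 2: "schauder u B2 m2" "B1 \<subseteq> sgr B2" "Y \<subseteq> grp B2" using reachD[OF Y 1(1)] by blast
    have "B \<subseteq> sgr B2" using 1(2) sgr_mono[OF 2(2)] by blast
    moreover have "X \<union> Y \<subseteq> grp B2" using 1(3) 2(3) grp_mono[OF 2(2)] by blast
    ultimately show "\<exists>B' m'. schauder u B' m' \<and> B \<subseteq> sgr B' \<and> X \<union> Y \<subseteq> grp B'" using 2(1) by blast
  qed
  have reach_pprt: "reach {x, y, pprt (x - y)}" if x: "reach {x}" and y: "reach {y}" for x y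
    unfolding reach_def
  proof (intro allI impI)
    fix B m assume B: "schauder u B m" "B0 \<subseteq> grp B"
    obtain B1 m1 where 1: "schauder u B1 m1" "B \<subseteq> sgr B1" "x \<in> grp B1" "y \<in> grp B1"
      using reachD[OF reach_Un[OF x y] B] by auto
    obtain B2 m2 where 2: "schauder u B2 m2" "B1 \<subseteq> sgr B2" "pprt (x - y) \<in> sgr B2"
      using schauder_refine_pprt[OF 1(1) grp_diff[OF 1(3,4)]] by blast
    have "B \<subseteq> sgr B2" using 1(2) sgr_mono[OF 2(2)] by blast
    moreover have "{x, y, pprt (x - y)} \<subseteq> grp B2"
      using 1(3,4) 2(3) grp_mono[OF 2(2)] sgr_subset_grp by blast
    ultimately show "\<exists>B' m'. schauder u B' m' \<and> B \<subseteq> sgr B' \<and> {x, y, pprt (x - y)} \<subseteq> grp B'"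
      using 2(1) by blast
  qed
  have "x \<in> l_generated B0" by (simp add: B0.generates)
  then have "reach {x}"
  proof induction
    case (gen b)
    then show ?case using schauder_subset_sgr unfolding reach_def by blast
  next
    case zero
    then show ?case using schauder_subset_sgr zero_in_grp unfolding reach_def by blast
  next
    case (add x y)
    show ?case by (rule reach_mono[OF reach_Un[OF add.IH]]) (auto intro: grp_add)
  next
    case (neg x)
    show ?case by (rule reach_mono[OF neg.IH]) (auto intro: grp_minus)
  next
    case (sup x y)
    have "sup x y = pprt (x - y) + y" by (simp add: pprt_def add_sup_distrib_right)
    then show ?case by (intro reach_mono[OF reach_pprt[OF sup.IH]]) (auto intro: grp_add)
  next
    case (inf x y)
    have "inf x y = x - pprt (x - y)"
      by (simp add: pprt_def diff_sup_eq_inf add_inf_distrib_left inf_commute)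
    then show ?case by (intro reach_mono[OF reach_pprt[OF inf.IH]]) (auto intro: grp_diff)
  qed
  then show ?thesis using reachD assms(2,3) by blast
qed

lemma schauder_refine_nonneg:
  fixes u :: "'a::lattice_ab_group_add"
  assumes B: "schauder u B m" and F: "finite F" "\<And>x. x \<in> F \<Longrightarrow> 0 \<le> x"
  shows "\<exists>B' m'. schauder u B' m' \<and> B \<subseteq> sgr B' \<and> F \<subseteq> sgr B'"
  using F
proof (induction F rule: finite_induct)
  case empty
  show ?case using B schauder_subset_sgr[OF B] by blast
next
  case (insert x F)
  then obtain B1 m1 where 1: "schauder u B1 m1" "B \<subseteq> sgr B1" "F \<subseteq> sgr B1" by auto
  have "B1 \<subseteq> grp B1"
    using schauder_subset_sgr[OF 1(1)] sgr_subset_grp by blast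
  then obtain B2 m2 where 2: "schauder u B2 m2" "B1 \<subseteq> sgr B2" "x \<in> grp B2"
    using schauder_refine_grp[OF 1(1,1)] by blast
  obtain B3 m3 where 3: "schauder u B3 m3" "B2 \<subseteq> sgr B3" "pprt x \<in> sgr B3"
    using schauder_refine_pprt[OF 2(1,3)] by blast
  have "sgr B1 \<subseteq> sgr B3" using sgr_mono[OF 2(2)] sgr_mono[OF 3(2)] by blast
  moreover have "pprt x = x" using insert.prems by simp
  ultimately show ?case using 1 3 by auto
qed

section \<open>Partially ordered groups\<close>

lemma P_object_additive:
  fixes v :: "'a::ab_group_add"
  assumes A: "0 \<in> A" "\<And>x y. x \<in> A \<Longrightarrow> y \<in> A \<Longrightarrow> x + y \<in> A" "\<And>x. x \<in> A \<Longrightarrow> - x \<in> A"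
    and C: "C \<subseteq> A" "0 \<in> C" "\<And>x y. x \<in> C \<Longrightarrow> y \<in> C \<Longrightarrow> x + y \<in> C" "\<And>x. x \<in> C \<Longrightarrow> - x \<in> C \<Longrightarrow> x = 0"
    and v: "v \<in> A" "\<And>x. x \<in> A \<Longrightarrow> \<exists>n::nat. n \<ge> 1 \<and> int n \<odot> v - x \<in> C"
  shows "P_object \<lparr>carrier = A, mult = (+), one = 0, pcone = C, punit = v\<rparr>" (is "P_object ?H")
proof -
  have cg: "comm_group ?H"
    by (rule comm_groupI) (use A in \<open>auto simp: ac_simps intro: bexI[of _ "- _"]\<close>)
  interpret comm_group ?H by (rule cg)
  have inv: "inv\<^bsub>?H\<^esub> x = - x" if "x \<in> A" for x
    by (rule inv_equality) (use that A in auto)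
  have pow: "x [^]\<^bsub>?H\<^esub> (n::nat) = int n \<odot> x" for x n
    by (induction n) (simp_all add: nat_pow_def zmult_add_left add.commute)
  show ?thesis
    unfolding P_object_def using cg C v by (auto simp: inv pow subset_iff)
qed

lemma P_object_dim_group: "order_unit u \<Longrightarrow> P_object (dim_group u)"
  unfolding dim_group_def order_unit_def by (rule P_object_additive) auto

text \<open>A vector with positive entries is an order-unit of \<open>\<int>\<^sup>n\<close>.\<close>
lemma multiple_dominates:
  fixes v x :: "nat \<Rightarrow> int"
  assumes v: "\<And>i. i < n \<Longrightarrow> 1 \<le> v i"
  shows "\<exists>k::nat. k \<ge> 1 \<and> (\<forall>i<n. x i \<le> int k * v i)"
proof -
  define s where "s = (\<Sum>i<n. \<bar>x i\<bar>)"
  have s: "\<bar>x i\<bar> \<le> s" if "i < n" for i unfolding s_def by (rule member_le_sum) (use that in auto)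
  have "0 \<le> s" unfolding s_def by (rule sum_nonneg) simp
  have "x i \<le> int (Suc (nat s)) * v i" if i: "i < n" for i
  proof -
    have "x i \<le> int (Suc (nat s)) * 1" using s[OF i] \<open>0 \<le> s\<close> by simp
    also have "\<dots> \<le> int (Suc (nat s)) * v i" using v[OF i] by (intro mult_left_mono) simp_all
    finally show ?thesis .
  qed
  then show ?thesis by (intro exI[of _ "Suc (nat s)"]) simp
qed

lemma P_object_int_power:
  assumes v: "v \<in> {..<n} \<rightarrow>\<^sub>E {1..}"
  shows "P_object (int_power n v)" (is "P_object ?H")
proof -
  have sel: "carrier ?H = {..<n} \<rightarrow>\<^sub>E UNIV" "pcone ?H = {..<n} \<rightarrow>\<^sub>E {0..}" "punit ?H = v"
    "x \<otimes>\<^bsub>?H\<^esub> y = (\<lambda>i\<in>{..<n}. x i + y i)" "\<one>\<^bsub>?H\<^esub> = (\<lambda>i\<in>{..<n}. 0)" for x y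
    by (simp_all add: int_power_def)
  have cg: "comm_group ?H"
  proof (rule comm_groupI)
    fix x assume "x \<in> carrier ?H"
    then show "\<exists>y\<in>carrier ?H. y \<otimes>\<^bsub>?H\<^esub> x = \<one>\<^bsub>?H\<^esub>"
      by (intro bexI[of _ "\<lambda>i\<in>{..<n}. - x i"]) (auto simp: sel fun_eq_iff)
  qed (auto simp: sel fun_eq_iff PiE_def extensional_def)
  interpret comm_group ?H by (rule cg)
  have inv: "inv\<^bsub>?H\<^esub> x = (\<lambda>i\<in>{..<n}. - x i)" if "x \<in> carrier ?H" for x
    by (rule inv_equality) (use that in \<open>auto simp: sel fun_eq_iff\<close>)
  have pow: "i < n \<Longrightarrow> (x [^]\<^bsub>?H\<^esub> (k::nat)) i = int k * x i" for x k i
    by (induction k) (simp_all add: nat_pow_def sel algebra_simps)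
  have vc: "v \<in> carrier ?H" using v by (auto simp: sel PiE_def)
  have "\<exists>k::nat. k \<ge> 1 \<and> (v [^]\<^bsub>?H\<^esub> k) \<otimes>\<^bsub>?H\<^esub> inv\<^bsub>?H\<^esub> x \<in> pcone ?H" if x: "x \<in> carrier ?H" for x
  proof -
    obtain k :: nat where "k \<ge> 1" "\<forall>i<n. x i \<le> int k * v i"
      using multiple_dominates[of n v x] v by (auto simp: PiE_def Pi_def)
    then show ?thesis by (intro exI[of _ k]) (auto simp: sel inv[OF x] pow)
  qed
  moreover have "x = \<one>\<^bsub>?H\<^esub>" if "x \<in> pcone ?H" "inv\<^bsub>?H\<^esub> x \<in> pcone ?H" for x
  proof -
    have "x \<in> carrier ?H" using that(1) by (auto simp: sel PiE_def)
    from inv[OF this] that have "x i = 0" if "i < n" for i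
      using that by (force simp: sel PiE_def Pi_def intro: antisym)
    then show ?thesis using that(1) by (auto simp: sel fun_eq_iff PiE_def extensional_def)
  qed
  moreover have "pcone ?H \<subseteq> carrier ?H" "\<one>\<^bsub>?H\<^esub> \<in> pcone ?H"
    by (auto simp: sel PiE_def)
  moreover have "x \<otimes>\<^bsub>?H\<^esub> y \<in> pcone ?H" if "x \<in> pcone ?H" "y \<in> pcone ?H" for x y
    using that by (auto simp: sel PiE_def Pi_def)
  ultimately show ?thesis
    unfolding P_object_def sel(3) using cg vc by blast
qed

lemma P_morphism_id: "P_object H \<Longrightarrow> P_morphism H H (\<lambda>x. x)"
  by (simp add: P_morphism_def hom_def)

lemma P_morphism_comp: "P_morphism H K f \<Longrightarrow> P_morphism K L g \<Longrightarrow> P_morphism H L (\<lambda>x. g (f x))"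
  by (auto simp: P_morphism_def hom_def image_subset_iff Pi_iff)

lemma P_morphism_closed: "P_morphism H K f \<Longrightarrow> x \<in> carrier H \<Longrightarrow> f x \<in> carrier K"
  by (auto simp: P_morphism_def hom_def)

text \<open>
  The usual uniqueness of limits. Each of the two limits has to be compared with itself as well as
  with the other one, so both universal properties are needed for both types of elements.
\<close>
lemma P_direct_limit_unique:
  fixes L :: "'c pogroup" and D :: "'d pogroup"
  assumes LC: "P_direct_limit TYPE('c) I leq H f L p" and LD: "P_direct_limit TYPE('d) I leq H f L p"
    and DC: "P_direct_limit TYPE('c) I leq H f D q" and DD: "P_direct_limit TYPE('d) I leq H f D q"
  shows "P_isomorphic L D"
proof -
  have coL: "P_cocone I leq H f L p" and coD: "P_cocone I leq H f D q"
    using LC DC unfolding P_direct_limit_def by blast+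
  obtain g where g: "P_morphism L D g" "\<forall>i\<in>I. \<forall>x\<in>carrier (H i). g (p i x) = q i x"
    using LD coD unfolding P_direct_limit_def by blast
  obtain h where h: "P_morphism D L h" "\<forall>i\<in>I. \<forall>x\<in>carrier (H i). h (q i x) = p i x"
    using DC coL unfolding P_direct_limit_def by blast
  have objs: "P_object L" "P_object D" using coL coD unfolding P_cocone_def by blast+
  have "h (g x) = x" if "x \<in> carrier L" for x
  proof -
    obtain e where e: "\<forall>e'. P_morphism L L e' \<and> (\<forall>i\<in>I. \<forall>x\<in>carrier (H i). e' (p i x) = p i x) \<longrightarrow> (\<forall>y\<in>carrier L. e' y = e y)"
      using LC coL unfolding P_direct_limit_def by blast
    have "h (g x) = e x" using e[rule_format, of "\<lambda>x. h (g x)"] P_morphism_comp[OF g(1) h(1)] g(2) h(2) that by simp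
    moreover have "x = e x" using e[rule_format, of "\<lambda>x. x"] P_morphism_id[OF objs(1)] that by simp
    ultimately show ?thesis by simp
  qed
  moreover have "g (h y) = y" if "y \<in> carrier D" for y
  proof -
    obtain e where e: "\<forall>e'. P_morphism D D e' \<and> (\<forall>i\<in>I. \<forall>x\<in>carrier (H i). e' (q i x) = q i x) \<longrightarrow> (\<forall>y\<in>carrier D. e' y = e y)"
      using DD coD unfolding P_direct_limit_def by blast
    have "g (h y) = e y" using e[rule_format, of "\<lambda>x. g (h x)"] P_morphism_comp[OF h(1) g(1)] g(2) h(2) that by simp
    moreover have "y = e y" using e[rule_format, of "\<lambda>x. x"] P_morphism_id[OF objs(2)] that by simp
    ultimately show ?thesis by simp
  qed
  ultimately show ?thesis unfolding P_isomorphic_def using g(1) h(1) by blast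
qed

section \<open>Coordinates\<close>

lemma lin_comb_cong: "(\<And>i. i < length bs \<Longrightarrow> c i = d i) \<Longrightarrow> lin_comb bs c = lin_comb bs d"
  by (simp add: lin_comb_def)

lemma lin_comb_add: "lin_comb bs (\<lambda>i\<in>{..<length bs}. c i + d i) = lin_comb bs c + lin_comb bs d"
  by (simp add: lin_comb_def zmult_add_left sum.distrib)

lemma lin_comb_of_fun:
  assumes "distinct bs"
  shows "lin_comb bs (\<lambda>i. f (bs ! i)) = (\<Sum>b\<in>set bs. f b \<odot> b)"
  unfolding lin_comb_def
  by (rule sum.reindex_bij_betw) (rule bij_betw_nth[OF assms refl refl])

lemma lin_comb_as_sum:
  assumes "distinct bs"
  shows "\<exists>f. lin_comb bs c = (\<Sum>b\<in>set bs. f b \<odot> b) \<and> (\<forall>i<length bs. f (bs ! i) = c i)"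
proof -
  define f where "f b = c (inv_into {..<length bs} ((!) bs) b)" for b
  have f: "f (bs ! i) = c i" if "i < length bs" for i
    using that bij_betw_imp_inj_on[OF bij_betw_nth[OF assms refl refl]] by (simp add: f_def inv_into_f_f)
  have "lin_comb bs c = lin_comb bs (\<lambda>i. f (bs ! i))" by (rule lin_comb_cong) (simp add: f)
  then show ?thesis using f lin_comb_of_fun[OF assms, of f] by auto
qed

locale basis_list =
  fixes u :: "'a::lattice_ab_group_add" and bs :: "'a list"
  assumes unit: "order_unit u" and distinct_bs: "distinct bs" and basis: "set bs \<in> bases u"
begin

lemma schauder_bs: "\<exists>m. schauder u (set bs) m"
  using is_basis_imp_schauder[OF unit] basis by (simp add: bases_def)

lemma lin_comb_inj:
  assumes "c \<in> {..<length bs} \<rightarrow>\<^sub>E S" "d \<in> {..<length bs} \<rightarrow>\<^sub>E T" "lin_comb bs c = lin_comb bs d"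
  shows "c = d"
proof (rule extensionalityI)
  show "c \<in> extensional {..<length bs}" "d \<in> extensional {..<length bs}"
    using assms(1,2) by (simp_all add: PiE_def)
  fix i assume "i \<in> {..<length bs}"
  obtain m where "schauder u (set bs) m" using schauder_bs by blast
  then interpret schauder u "set bs" m .
  obtain f where f: "lin_comb bs c = (\<Sum>b\<in>set bs. f b \<odot> b)" "\<forall>i<length bs. f (bs ! i) = c i"
    using lin_comb_as_sum[OF distinct_bs] by blast
  obtain g where g: "lin_comb bs d = (\<Sum>b\<in>set bs. g b \<odot> b)" "\<forall>i<length bs. g (bs ! i) = d i"
    using lin_comb_as_sum[OF distinct_bs] by blast
  have "f (bs ! i) = g (bs ! i)"
    using independent[of f g "bs ! i"] f(1) g(1) assms(3) \<open>i \<in> {..<length bs}\<close> by simp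
  then show "c i = d i" using f(2) g(2) \<open>i \<in> {..<length bs}\<close> by simp
qed

lemma lin_comb_preimage:
  assumes "x = (\<Sum>b\<in>set bs. f b \<odot> b)" "\<And>b. b \<in> set bs \<Longrightarrow> f b \<in> S"
  shows "\<exists>c\<in>{..<length bs} \<rightarrow>\<^sub>E S. lin_comb bs c = x"
proof
  show "(\<lambda>i\<in>{..<length bs}. f (bs ! i)) \<in> {..<length bs} \<rightarrow>\<^sub>E S" using assms(2) by auto
  show "lin_comb bs (\<lambda>i\<in>{..<length bs}. f (bs ! i)) = x"
    unfolding assms(1) lin_comb_of_fun[OF distinct_bs, of f, symmetric] by (rule lin_comb_cong) simp
qed

lemma grp_eq_lin_comb: "grp (set bs) = lin_comb bs ` ({..<length bs} \<rightarrow>\<^sub>E UNIV)"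
proof (intro subset_antisym subsetI)
  fix x assume "x \<in> grp (set bs)"
  then obtain f where f: "x = (\<Sum>b\<in>set bs. f b \<odot> b)" by (auto simp: grp_def)
  then obtain c where "c \<in> {..<length bs} \<rightarrow>\<^sub>E UNIV" "lin_comb bs c = x"
    using lin_comb_preimage[OF f, of UNIV] by auto
  then show "x \<in> lin_comb bs ` ({..<length bs} \<rightarrow>\<^sub>E UNIV)" by (metis imageI)
next
  fix x assume "x \<in> lin_comb bs ` ({..<length bs} \<rightarrow>\<^sub>E UNIV)"
  then obtain c where c: "x = lin_comb bs c" by auto
  show "x \<in> grp (set bs)"
    unfolding c lin_comb_def by (intro grp_sum grp_zmult subsetD[OF sgr_subset_grp] in_sgr) auto
qed

lemma sgr_eq_lin_comb: "sgr (set bs) = lin_comb bs ` ({..<length bs} \<rightarrow>\<^sub>E {0..})"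
proof
  show "sgr (set bs) \<subseteq> lin_comb bs ` ({..<length bs} \<rightarrow>\<^sub>E {0..})"
  proof
    fix x assume "x \<in> sgr (set bs)"
    then obtain f where f: "x = (\<Sum>b\<in>set bs. f b \<odot> b)" "\<forall>b\<in>set bs. 0 \<le> f b" by (auto simp: sgr_def)
    then obtain c where "c \<in> {..<length bs} \<rightarrow>\<^sub>E {0..}" "lin_comb bs c = x"
      using lin_comb_preimage[OF f(1), of "{0..}"] by auto
    then show "x \<in> lin_comb bs ` ({..<length bs} \<rightarrow>\<^sub>E {0..})" by (metis imageI)
  qed
  show "lin_comb bs ` ({..<length bs} \<rightarrow>\<^sub>E {0..}) \<subseteq> sgr (set bs)"
  proof
    fix x assume "x \<in> lin_comb bs ` ({..<length bs} \<rightarrow>\<^sub>E {0..})"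
    then obtain c where c: "c \<in> {..<length bs} \<rightarrow>\<^sub>E {0..}" "x = lin_comb bs c" by blast
    show "x \<in> sgr (set bs)"
      unfolding c(2) lin_comb_def using c(1) by (intro sgr_sum sgr_zmult in_sgr) auto
  qed
qed

lemma coords:
  assumes "x \<in> sgr (set bs)"
  shows "coords bs x \<in> {..<length bs} \<rightarrow>\<^sub>E {0..}" "lin_comb bs (coords bs x) = x"
proof -
  obtain c where c: "c \<in> {..<length bs} \<rightarrow>\<^sub>E {0..}" "lin_comb bs c = x" using assms unfolding sgr_eq_lin_comb by blast
  then have "\<exists>!c. c \<in> {..<length bs} \<rightarrow>\<^sub>E {0..} \<and> lin_comb bs c = x" using lin_comb_inj by metis
  from theI'[OF this] show "coords bs x \<in> {..<length bs} \<rightarrow>\<^sub>E {0..}" "lin_comb bs (coords bs x) = x"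
    unfolding coords_def by blast+
qed

lemma multiplicities:
  shows "multiplicities u bs \<in> {..<length bs} \<rightarrow>\<^sub>E {1..}" "lin_comb bs (multiplicities u bs) = u"
proof -
  obtain m where "schauder u (set bs) m" using schauder_bs by blast
  then interpret schauder u "set bs" m .
  obtain c where c: "c \<in> {..<length bs} \<rightarrow>\<^sub>E {1..}" "lin_comb bs c = u"
    using lin_comb_preimage[of u m "{1..}"] unit_eq mult_ge_1 by auto
  then have "\<exists>!c. c \<in> {..<length bs} \<rightarrow>\<^sub>E {1..} \<and> lin_comb bs c = u" using lin_comb_inj by metis
  from theI'[OF this] show "multiplicities u bs \<in> {..<length bs} \<rightarrow>\<^sub>E {1..}" "lin_comb bs (multiplicities u bs) = u"
    unfolding multiplicities_def by blast+
qed

lemma Z_basis_simps: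
  "carrier (Z_basis u bs) = {..<length bs} \<rightarrow>\<^sub>E UNIV" "pcone (Z_basis u bs) = {..<length bs} \<rightarrow>\<^sub>E {0..}"
  "punit (Z_basis u bs) = multiplicities u bs"
  "x \<otimes>\<^bsub>Z_basis u bs\<^esub> y = (\<lambda>i\<in>{..<length bs}. x i + y i)"
  by (simp_all add: Z_basis_def int_power_def)

lemma P_object_Z_basis: "P_object (Z_basis u bs)"
  unfolding Z_basis_def by (rule P_object_int_power) (rule multiplicities)

lemma unital_simplicial_Z_basis: "unital_simplicial_group (Z_basis u bs)"
proof -
  have "bs \<noteq> []" using basis by (auto simp: bases_def is_basis_def)
  moreover have "P_isomorphic (Z_basis u bs) (Z_basis u bs)"
    unfolding P_isomorphic_def using P_morphism_id[OF P_object_Z_basis] by blast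
  ultimately show ?thesis
    using P_object_Z_basis unfolding unital_simplicial_group_def Z_basis_def by blast
qed

lemma sgr_nonneg: "x \<in> sgr (set bs) \<Longrightarrow> 0 \<le> x"
  using basis unfolding sgr_def bases_def is_basis_def by (auto intro!: sum_nonneg zmult_nonneg)

lemma P_object_basic_group: "P_object (basic_group u (set bs))"
  unfolding basic_group_def
proof (rule P_object_additive)
  show "x = 0" if "x \<in> sgr (set bs)" "- x \<in> sgr (set bs)" for x
    using sgr_nonneg[OF that(1)] sgr_nonneg[OF that(2)] by simp
  show "u \<in> grp (set bs)"
    using multiplicities unfolding grp_eq_lin_comb by (auto intro!: image_eqI[of u _ "multiplicities u bs"] simp: PiE_def)
  fix x assume "x \<in> grp (set bs)"
  then obtain c where c: "c \<in> {..<length bs} \<rightarrow>\<^sub>E UNIV" "x = lin_comb bs c" unfolding grp_eq_lin_comb by blast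
  obtain k :: nat where k: "k \<ge> 1" "\<forall>i<length bs. c i \<le> int k * multiplicities u bs i"
    using multiple_dominates[of "length bs" "multiplicities u bs" c] multiplicities(1)
    by (auto simp: PiE_def Pi_def)
  have "(\<Sum>i<length bs. (int k * multiplicities u bs i - c i) \<odot> bs ! i) \<in> sgr (set bs)"
    using k(2) by (intro sgr_sum sgr_zmult in_sgr) auto
  also have "(\<Sum>i<length bs. (int k * multiplicities u bs i - c i) \<odot> bs ! i) = int k \<odot> u - x"
    using arg_cong[OF multiplicities(2), of "\<lambda>z. int k \<odot> z"] unfolding c(2) lin_comb_def
    by (simp add: zmult_diff_left sum_subtractf zmult_sum_right zmult_zmult)
  finally show "\<exists>n::nat. n \<ge> 1 \<and> int n \<odot> u - x \<in> sgr (set bs)" using k(1) by blast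
qed (simp_all add: sgr_subset_grp zero_in_grp zero_in_sgr grp_add sgr_add grp_minus)

lemma P_morphism_lin_comb: "P_morphism (Z_basis u bs) (dim_group u) (lin_comb bs)"
  unfolding P_morphism_def
proof (intro conjI)
  show "lin_comb bs \<in> hom (Z_basis u bs) (dim_group u)"
    by (auto simp: hom_def Z_basis_simps dim_group_def lin_comb_add)
  show "lin_comb bs ` pcone (Z_basis u bs) \<subseteq> pcone (dim_group u)"
    using sgr_nonneg sgr_eq_lin_comb by (auto simp: Z_basis_simps dim_group_def)
  show "lin_comb bs (punit (Z_basis u bs)) = punit (dim_group u)"
    using multiplicities by (simp add: Z_basis_simps dim_group_def)
qed (rule P_object_Z_basis P_object_dim_group[OF unit])+

end

text \<open>
  A basis and a refinement. Up to the coordinates, the map \<open>phi\<close> is the inclusion of the spanned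
  groups (\<open>lin_comb_phi\<close>); all its properties follow from this and the injectivity of coordinates.
\<close>
locale basis_list_pair = dom: basis_list u bs + cod: basis_list u bs'
  for u :: "'a::lattice_ab_group_add" and bs bs' +
  assumes subset: "set bs \<subseteq> sgr (set bs')"
begin

lemma phi_closed: "phi bs bs' y \<in> {..<length bs'} \<rightarrow>\<^sub>E UNIV"
  by (simp add: phi_def)

lemma lin_comb_phi: "lin_comb bs' (phi bs bs' y) = lin_comb bs y"
proof -
  have "lin_comb bs' (phi bs bs' y) = (\<Sum>k<length bs'. \<Sum>i<length bs. (M_matrix bs bs' k i * y i) \<odot> bs' ! k)"
    by (simp add: lin_comb_def phi_def zmult_sum_left)
  also have "\<dots> = (\<Sum>i<length bs. \<Sum>k<length bs'. (M_matrix bs bs' k i * y i) \<odot> bs' ! k)"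
    by (rule sum.swap)
  also have "\<dots> = (\<Sum>i<length bs. y i \<odot> lin_comb bs' (coords bs' (bs ! i)))"
    by (simp add: lin_comb_def M_matrix_def zmult_sum_right zmult_zmult mult.commute)
  also have "\<dots> = lin_comb bs y"
    unfolding lin_comb_def[of bs] using subset cod.coords(2)
    by (intro sum.cong refl) (metis lessThan_iff nth_mem subsetD)
  finally show ?thesis .
qed

lemma phi_eqI: "c \<in> {..<length bs'} \<rightarrow>\<^sub>E UNIV \<Longrightarrow> lin_comb bs' c = lin_comb bs y \<Longrightarrow> phi bs bs' y = c"
  using cod.lin_comb_inj[OF phi_closed] lin_comb_phi by simp

lemma P_morphism_phi: "P_morphism (Z_basis u bs) (Z_basis u bs') (phi bs bs')"
  unfolding P_morphism_def
proof (intro conjI)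
  show "phi bs bs' \<in> hom (Z_basis u bs) (Z_basis u bs')"
    unfolding hom_def
  proof (intro CollectI conjI ballI)
    show "phi bs bs' \<in> carrier (Z_basis u bs) \<rightarrow> carrier (Z_basis u bs')"
      using phi_closed by (auto simp: cod.Z_basis_simps)
    fix x y
    show "phi bs bs' (x \<otimes>\<^bsub>Z_basis u bs\<^esub> y) = phi bs bs' x \<otimes>\<^bsub>Z_basis u bs'\<^esub> phi bs bs' y"
      by (rule phi_eqI) (simp_all add: dom.Z_basis_simps cod.Z_basis_simps lin_comb_add lin_comb_phi)
  qed
  show "phi bs bs' ` pcone (Z_basis u bs) \<subseteq> pcone (Z_basis u bs')"
  proof
    fix z assume "z \<in> phi bs bs' ` pcone (Z_basis u bs)"
    then obtain y where y: "y \<in> {..<length bs} \<rightarrow>\<^sub>E {0..}" "z = phi bs bs' y" by (auto simp: dom.Z_basis_simps)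
    have "lin_comb bs y \<in> sgr (set bs')"
      using y(1) dom.sgr_eq_lin_comb sgr_mono[OF subset] by blast
    then obtain c where c: "c \<in> {..<length bs'} \<rightarrow>\<^sub>E {0..}" "lin_comb bs' c = lin_comb bs y"
      unfolding cod.sgr_eq_lin_comb by (metis imageE)
    have "z = c" unfolding y(2) by (rule phi_eqI) (use c in \<open>auto simp: PiE_def\<close>)
    then show "z \<in> pcone (Z_basis u bs')" using c(1) by (simp add: cod.Z_basis_simps)
  qed
  show "phi bs bs' (punit (Z_basis u bs)) = punit (Z_basis u bs')"
    by (rule phi_eqI) (use dom.multiplicities cod.multiplicities in
      \<open>auto simp: dom.Z_basis_simps cod.Z_basis_simps PiE_def\<close>)
qed (rule dom.P_object_Z_basis cod.P_object_Z_basis)+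

lemma inj_on_phi: "inj_on (phi bs bs') (carrier (Z_basis u bs))"
proof (rule inj_onI)
  fix x y assume "x \<in> carrier (Z_basis u bs)" "y \<in> carrier (Z_basis u bs)" "phi bs bs' x = phi bs bs' y"
  then show "x = y" using dom.lin_comb_inj lin_comb_phi unfolding dom.Z_basis_simps by metis
qed

lemma P_morphism_inclusion: "P_morphism (basic_group u (set bs)) (basic_group u (set bs')) (\<lambda>x. x)"
  using dom.P_object_basic_group cod.P_object_basic_group grp_mono[OF subset] sgr_mono[OF subset]
  by (auto simp: P_morphism_def basic_group_def hom_def)

end

section \<open>The direct limit\<close>

locale basis_system =
  fixes u :: "'a::lattice_ab_group_add" and listing :: "'a set \<Rightarrow> 'a list"
  assumes unit: "order_unit u" and ex_basis: "\<exists>B. B \<in> bases u"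
    and listing: "\<And>B. B \<in> bases u \<Longrightarrow> distinct (listing B) \<and> set (listing B) = B"
begin

abbreviation leq :: "'a set \<Rightarrow> 'a set \<Rightarrow> bool" where "leq B B' \<equiv> B \<subseteq> sgr B'"
abbreviation Z :: "'a set \<Rightarrow> (nat \<Rightarrow> int) pogroup" where "Z B \<equiv> Z_basis u (listing B)"
abbreviation \<phi> :: "'a set \<Rightarrow> 'a set \<Rightarrow> (nat \<Rightarrow> int) \<Rightarrow> nat \<Rightarrow> int" where "\<phi> B B' \<equiv> phi (listing B) (listing B')"

lemma basis_list: "B \<in> bases u \<Longrightarrow> basis_list u (listing B)"
  using unit listing[of B] by unfold_locales auto

lemma basis_list_pair: "B \<in> bases u \<Longrightarrow> B' \<in> bases u \<Longrightarrow> leq B B' \<Longrightarrow> basis_list_pair u (listing B) (listing B')"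
  using unit listing[of B] listing[of B'] by unfold_locales auto

text \<open>
  The only place where the theory of subdivisions enters the direct system; \<open>F\<close> is another basis,
  or consists of elements that have to be expressed with nonnegative coefficients.
\<close>
lemma basis_refines:
  assumes B: "B \<in> bases u" and F: "finite F" "\<And>x. x \<in> F \<Longrightarrow> 0 \<le> x"
  shows "\<exists>B'\<in>bases u. B \<subseteq> sgr B' \<and> F \<subseteq> sgr B'"
proof -
  obtain m where "schauder u B m" using is_basis_imp_schauder[OF unit] B by (auto simp: bases_def)
  then obtain B' m' where B': "schauder u B' m'" "B \<subseteq> sgr B'" "F \<subseteq> sgr B'"
    using schauder_refine_nonneg[OF _ F] by blast
  have "B' \<in> bases u" using schauder_imp_is_basis[OF unit B'(1)] by (simp add: bases_def)
  then show ?thesis using B'(2,3) by blast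
qed

lemma directed:
  assumes "B \<in> bases u" "F \<in> bases u"
  shows "\<exists>B'\<in>bases u. leq B B' \<and> leq F B'"
  using basis_refines[OF assms(1), of F] assms(2) by (auto simp: bases_def is_basis_def)

lemma jointly_represented: "\<exists>B\<in>bases u. x \<in> grp B \<and> y \<in> grp B"
proof -
  obtain B where "B \<in> bases u" using ex_basis by blast
  then have "\<exists>B'\<in>bases u. B \<subseteq> sgr B' \<and> {pprt x, pprt (- x), pprt y, pprt (- y)} \<subseteq> sgr B'"
    by (rule basis_refines) (simp, metis empty_iff insert_iff zero_le_pprt)
  then obtain B' where B': "B' \<in> bases u" "{pprt x, pprt (- x), pprt y, pprt (- y)} \<subseteq> sgr B'"
    by blast
  then have "pprt x - pprt (- x) \<in> grp B'" "pprt y - pprt (- y) \<in> grp B'"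
    using sgr_subset_grp by (blast intro: grp_diff)+
  then show ?thesis using B'(1) diff_pprt_eq by metis
qed

lemma direct_system: "P_direct_system (bases u) leq Z \<phi>"
  unfolding P_direct_system_def
proof (intro conjI ballI impI)
  show "bases u \<noteq> {}" using ex_basis by blast
  show "leq B B" if "B \<in> bases u" for B using that in_sgr by (auto simp: bases_def is_basis_def)
  show "leq B B''" if "leq B B' \<and> leq B' B''" for B B' B'' using that sgr_mono[of B' B''] by blast
  show "\<exists>B'\<in>bases u. leq B B' \<and> leq F B'" if "B \<in> bases u" "F \<in> bases u" for B F
    by (rule directed[OF that])
  show "P_object (Z B)" if "B \<in> bases u" for B
    by (rule basis_list.P_object_Z_basis[OF basis_list[OF that]])
  show "P_morphism (Z B) (Z B') (\<phi> B B')" if "B \<in> bases u" "B' \<in> bases u" "leq B B'" for B B'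
    by (rule basis_list_pair.P_morphism_phi[OF basis_list_pair[OF that]])
  show "\<phi> B B y = y" if "B \<in> bases u" "y \<in> carrier (Z B)" for B y
  proof -
    have "leq B B" using that(1) in_sgr by (auto simp: bases_def is_basis_def)
    then interpret basis_list_pair u "listing B" "listing B" using basis_list_pair that(1) by blast
    show ?thesis by (rule phi_eqI) (use that(2) in \<open>simp_all add: dom.Z_basis_simps\<close>)
  qed
  show "\<phi> B' B'' (\<phi> B B' y) = \<phi> B B'' y"
    if B: "B \<in> bases u" "B' \<in> bases u" "B'' \<in> bases u" and leq: "leq B B' \<and> leq B' B''" for B B' B'' y
  proof -
    have "leq B B''" using leq sgr_mono[of B' B''] by blast
    interpret p: basis_list_pair u "listing B" "listing B'" using basis_list_pair B leq by blast
    interpret q: basis_list_pair u "listing B'" "listing B''" using basis_list_pair B leq by blast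
    interpret r: basis_list_pair u "listing B" "listing B''" using basis_list_pair B \<open>leq B B''\<close> by blast
    show ?thesis by (rule q.phi_eqI) (simp_all add: r.phi_closed p.lin_comb_phi r.lin_comb_phi)
  qed
qed

lemma cocone: "P_cocone (bases u) leq Z \<phi> (dim_group u) (\<lambda>B. lin_comb (listing B))"
  unfolding P_cocone_def
  using P_object_dim_group[OF unit] basis_list.P_morphism_lin_comb[OF basis_list]
    basis_list_pair.lin_comb_phi[OF basis_list_pair] by blast

text \<open>
  A cocone takes the same value at all representations of an element of \<open>G\<close>, since two representations
  become equal in a common refinement.
\<close>
lemma cocone_agree:
  assumes q: "P_cocone (bases u) leq Z \<phi> K q"
    and B: "B \<in> bases u" "y \<in> carrier (Z B)" and F: "F \<in> bases u" "z \<in> carrier (Z F)"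
    and eq: "lin_comb (listing B) y = lin_comb (listing F) z"
  shows "q B y = q F z"
proof -
  obtain B' where B': "B' \<in> bases u" "leq B B'" "leq F B'" using directed[OF B(1) F(1)] by blast
  interpret p: basis_list_pair u "listing B" "listing B'" using basis_list_pair B B' by blast
  interpret r: basis_list_pair u "listing F" "listing B'" using basis_list_pair F B' by blast
  have "\<phi> B B' y = \<phi> F B' z" using eq by (intro p.phi_eqI) (simp_all add: r.phi_closed r.lin_comb_phi)
  moreover have "q B' (\<phi> B B' y) = q B y" "q B' (\<phi> F B' z) = q F z"
    using q B F B' unfolding P_cocone_def by blast+
  ultimately show ?thesis by simp
qed

lemma direct_limit:
  "P_direct_limit TYPE('d) (bases u) leq Z \<phi> (dim_group u) (\<lambda>B. lin_comb (listing B))"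
  unfolding P_direct_limit_def
proof (intro conjI allI impI cocone)
  fix K :: "'d pogroup" and q assume q: "P_cocone (bases u) leq Z \<phi> K q"
  have q_mor: "P_morphism (Z B) K (q B)" if "B \<in> bases u" for B
    using q that unfolding P_cocone_def by blast
  have rep: "\<exists>B\<in>bases u. \<exists>y\<in>carrier (Z B). \<exists>y'\<in>carrier (Z B).
      lin_comb (listing B) y = x \<and> lin_comb (listing B) y' = x'" for x x'
  proof -
    obtain B where B: "B \<in> bases u" "x \<in> grp B" "x' \<in> grp B" using jointly_represented by blast
    interpret basis_list u "listing B" by (rule basis_list[OF B(1)])
    have "grp B = lin_comb (listing B) ` carrier (Z B)"
      using grp_eq_lin_comb listing[OF B(1)] by (simp add: Z_basis_simps)
    with B(2,3) have "x \<in> lin_comb (listing B) ` carrier (Z B)" "x' \<in> lin_comb (listing B) ` carrier (Z B)"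
      by simp_all
    then show ?thesis using B(1) unfolding image_iff by fast
  qed
  define rp where "rp x = (SOME (B, y). B \<in> bases u \<and> y \<in> carrier (Z B) \<and> lin_comb (listing B) y = x)" for x
  define g where "g x = q (fst (rp x)) (snd (rp x))" for x
  have g: "g (lin_comb (listing B) y) = q B y" if "B \<in> bases u" "y \<in> carrier (Z B)" for B y
  proof -
    let ?P = "\<lambda>(F, z). F \<in> bases u \<and> z \<in> carrier (Z F) \<and> lin_comb (listing F) z = lin_comb (listing B) y"
    have "?P (B, y)" using that by simp
    then have "?P (rp (lin_comb (listing B) y))" unfolding rp_def by (rule someI)
    then show ?thesis unfolding g_def using cocone_agree[OF q] that by (metis (mono_tags, lifting) case_prod_beta)
  qed
  have "P_morphism (dim_group u) K g"
    unfolding P_morphism_def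
  proof (intro conjI)
    show "P_object (dim_group u)" by (rule P_object_dim_group[OF unit])
    show "P_object K" using q unfolding P_cocone_def by blast
    show "g \<in> hom (dim_group u) K"
      unfolding hom_def
    proof (intro CollectI conjI ballI)
      show "g \<in> carrier (dim_group u) \<rightarrow> carrier K"
      proof
        fix x
        obtain B y where B: "B \<in> bases u" "y \<in> carrier (Z B)" "lin_comb (listing B) y = x" using rep by metis
        then show "g x \<in> carrier K" using g P_morphism_closed[OF q_mor] by metis
      qed
      fix x x'
      obtain B y y' where B: "B \<in> bases u" "y \<in> carrier (Z B)" "y' \<in> carrier (Z B)"
        "lin_comb (listing B) y = x" "lin_comb (listing B) y' = x'" using rep by metis
      interpret basis_list u "listing B" by (rule basis_list[OF B(1)])
      have "lin_comb (listing B) (y \<otimes>\<^bsub>Z B\<^esub> y') = x + x'" using B by (simp add: Z_basis_simps lin_comb_add)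
      moreover have "y \<otimes>\<^bsub>Z B\<^esub> y' \<in> carrier (Z B)" by (simp add: Z_basis_simps)
      ultimately have "g (x + x') = q B (y \<otimes>\<^bsub>Z B\<^esub> y')" using g[OF B(1)] by metis
      also have "\<dots> = q B y \<otimes>\<^bsub>K\<^esub> q B y'" using q_mor[OF B(1)] B(2,3) by (simp add: P_morphism_def hom_def)
      also have "\<dots> = g x \<otimes>\<^bsub>K\<^esub> g x'" using g[OF B(1)] B by metis
      finally show "g (x \<otimes>\<^bsub>dim_group u\<^esub> x') = g x \<otimes>\<^bsub>K\<^esub> g x'" by (simp add: dim_group_def)
    qed
    show "g ` pcone (dim_group u) \<subseteq> pcone K"
    proof
      fix z assume "z \<in> g ` pcone (dim_group u)"
      then obtain x where x: "0 \<le> x" "z = g x" by (auto simp: dim_group_def)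
      obtain B0 where "B0 \<in> bases u" using ex_basis by blast
      then obtain B where B: "B \<in> bases u" "x \<in> sgr B" using basis_refines[of B0 "{x}"] x(1) by auto
      interpret basis_list u "listing B" by (rule basis_list[OF B(1)])
      obtain y where y: "y \<in> {..<length (listing B)} \<rightarrow>\<^sub>E {0..}" "lin_comb (listing B) y = x"
        using B(2) sgr_eq_lin_comb listing[OF B(1)] by auto
      have "y \<in> carrier (Z B)" using y(1) by (auto simp: Z_basis_simps PiE_def)
      then have "z = q B y" using g[OF B(1)] y(2) x(2) by metis
      moreover have "y \<in> pcone (Z B)" using y(1) by (simp add: Z_basis_simps)
      ultimately show "z \<in> pcone K" using q_mor[OF B(1)] unfolding P_morphism_def by blast
    qed
    obtain B where B: "B \<in> bases u" using ex_basis by blast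
    interpret basis_list u "listing B" by (rule basis_list[OF B])
    have "multiplicities u (listing B) \<in> carrier (Z B)" using multiplicities(1) by (auto simp: Z_basis_simps PiE_def)
    then have "g u = q B (punit (Z B))" using g[OF B] multiplicities(2) unfolding Z_basis_simps by metis
    also have "\<dots> = punit K" using q_mor[OF B] unfolding P_morphism_def by blast
    finally show "g (punit (dim_group u)) = punit K" by (simp add: dim_group_def)
  qed
  moreover have "g' x = g x"
    if "\<forall>B\<in>bases u. \<forall>y\<in>carrier (Z B). g' (lin_comb (listing B) y) = q B y" for g' x
  proof -
    obtain B y where "B \<in> bases u" "y \<in> carrier (Z B)" "lin_comb (listing B) y = x" using rep by metis
    then show ?thesis using that g by metis
  qed
  ultimately show "\<exists>g. P_morphism (dim_group u) K g \<and>
      (\<forall>B\<in>bases u. \<forall>y\<in>carrier (Z B). g (lin_comb (listing B) y) = q B y) \<and>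
      (\<forall>g'. P_morphism (dim_group u) K g' \<and>
        (\<forall>B\<in>bases u. \<forall>y\<in>carrier (Z B). g' (lin_comb (listing B) y) = q B y) \<longrightarrow>
        (\<forall>x\<in>carrier (dim_group u). g' x = g x))"
    using g by (intro exI[of _ g]) simp
qed

end

theorem theorem5p3:
  fixes u :: "'a::lattice_ab_group_add"
    and listing :: "'a set \<Rightarrow> 'a list"
  assumes "order_unit u"
    and "\<exists>B. B \<in> bases u"
    and "\<And>B. B \<in> bases u \<Longrightarrow> distinct (listing B) \<and> set (listing B) = B"
  shows
    "let leq = (\<lambda>B B'. B \<subseteq> sgr B');
         Z = (\<lambda>B. Z_basis u (listing B));
         \<phi> = (\<lambda>B B'. phi (listing B) (listing B'))
     in
       (\<forall>B\<in>bases u. \<forall>F\<in>bases u. \<exists>B'\<in>bases u.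
          P_morphism (basic_group u B) (basic_group u B') (\<lambda>x. x) \<and>
          P_morphism (basic_group u F) (basic_group u B') (\<lambda>x. x)) \<and>
       (P_direct_system (bases u) leq Z \<phi> \<and>
        (\<forall>B\<in>bases u. unital_simplicial_group (Z B)) \<and>
        (\<forall>B\<in>bases u. \<forall>B'\<in>bases u. leq B B' \<longrightarrow> inj_on (\<phi> B B') (carrier (Z B)))) \<and>
       (P_direct_limit TYPE('d) (bases u) leq Z \<phi> (dim_group u) (\<lambda>B. lin_comb (listing B)) \<and>
        (\<forall>(L :: 'd pogroup) p.
           P_direct_limit TYPE('a) (bases u) leq Z \<phi> L p \<and>
           P_direct_limit TYPE('d) (bases u) leq Z \<phi> L p \<longrightarrow>
           P_isomorphic L (dim_group u)))"
proof -
  interpret basis_system u listing using assms by unfold_locales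
  show ?thesis
    unfolding Let_def
  proof (intro conjI ballI allI impI)
    fix B F assume BF: "B \<in> bases u" "F \<in> bases u"
    obtain B' where B': "B' \<in> bases u" "leq B B'" "leq F B'" using directed[OF BF] by blast
    have "P_morphism (basic_group u E) (basic_group u B') (\<lambda>x. x)" if "E \<in> bases u" "leq E B'" for E
      using basis_list_pair.P_morphism_inclusion[OF basis_list_pair[OF that(1) B'(1) that(2)]]
        listing[OF that(1)] listing[OF B'(1)] by simp
    then show "\<exists>B'\<in>bases u. P_morphism (basic_group u B) (basic_group u B') (\<lambda>x. x) \<and>
        P_morphism (basic_group u F) (basic_group u B') (\<lambda>x. x)"
      using BF B' by blast
  next
    show "P_direct_system (bases u) leq Z \<phi>" by (rule direct_system)
  next
    fix B assume "B \<in> bases u"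
    then show "unital_simplicial_group (Z B)" by (rule basis_list.unital_simplicial_Z_basis[OF basis_list])
  next
    fix B B' assume "B \<in> bases u" "B' \<in> bases u" "leq B B'"
    then show "inj_on (\<phi> B B') (carrier (Z B))" by (rule basis_list_pair.inj_on_phi[OF basis_list_pair])
  next
    show "P_direct_limit TYPE('d) (bases u) leq Z \<phi> (dim_group u) (\<lambda>B. lin_comb (listing B))"
      by (rule direct_limit)
  next
    fix L :: "'d pogroup" and p
    assume "P_direct_limit TYPE('a) (bases u) leq Z \<phi> L p \<and> P_direct_limit TYPE('d) (bases u) leq Z \<phi> L p"
    then show "P_isomorphic L (dim_group u)"
      using P_direct_limit_unique[OF _ _ direct_limit direct_limit] by blast
  qed
qed

end
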